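(* $$\max\Big\{\mathrm{uB}(S(n_1,\ldots,n_k)) : 1+n_1+\cdots+n_k=n\Big\}=\left(\frac12-\frac{5}{6k}+\frac{1}{3k^2}\right)n^3+O(kn^2).$$
   Context: All graphs are finite, simple, and undirected. For a graph $G$ and two vertices $u,v$ of $G$, let $\mathrm{dist}_G(u,v)$ be the distance in $G$ between $u$ and $v$, and let $n_G(u,v)$ be the number of vertices $w$ of $G$ with $\mathrm{dist}_G(u,w)<\mathrm{dist}_G(v,w)$. The distance-unbalancedness of $G$ is $$\mathrm{uB}(G)=\sum_{\{u,v\}\in\binom{V(G)}{2}}|n_G(u,v)-n_G(v,u)|,$$ where $\binom{V(G)}{2}$ is the set of all $2$-element subsets of the vertex set $V(G)$ of $G$ (all unordered pairs of distinct vertices, not only edges). For positive integers $n_1,\ldots,n_k$, the subdivided star $S(n_1,\ldots,n_k)$ is the tree obtained from the star $K_{1,k}$ with the $k$ edges $e_1,\ldots,e_k$ by subdividing the edge $e_i$ exactly $n_i-1$ times for every $i\in\{1,\ldots,k\}$. Thus $S(n_1,\ldots,n_k)$ has order $1+n_1+\cdots+n_k$, and removing its center vertex yields a forest whose components are $k$ paths of orders $n_1,\ldots,n_k$. In the claim, $k$ is the number of these paths, $n$ is the order of the subdivided star, and the maximum is over the positive integers $n_1,\ldots,n_k$ with $1+n_1+\cdots+n_k=n$.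
   Formalization: The formula is proved for k at least 2 (and k < n, so that the maximum is over a nonempty set); for k = 1 it fails, since S(n_1) is a path with uB = n^3/6 + O(n^2) while the stated coefficient is 0. *)

theory Defs
  imports "Graph_Theory.Pair_Digraph" "Graph_Theory.Shortest_Path"
begin

text \<open>
  Finite simple undirected graphs are the finite, loopfree, symmetric digraphs of the locale
  \<^locale>\<open>pair_graph\<close>: an undirected edge is a pair of opposite arcs.
\<close>

definition graph_dist :: "'a pair_pre_digraph \<Rightarrow> 'a \<Rightarrow> 'a \<Rightarrow> ereal" where
  "graph_dist G u v = wf_digraph.\<mu> (with_proj G) (\<lambda>_. 1) u v"

definition num_closer :: "'a pair_pre_digraph \<Rightarrow> 'a \<Rightarrow> 'a \<Rightarrow> nat" where
  "num_closer G u v = card {w \<in> pverts G. graph_dist G u w < graph_dist G v w}"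

text \<open>
  The summand depends only on the unordered pair, so the description below is well defined;
  see the lemma \<open>pair_imbalance_doubleton\<close>.
\<close>

definition pair_imbalance :: "'a pair_pre_digraph \<Rightarrow> 'a set \<Rightarrow> int" where
  "pair_imbalance G P =
     (THE d. \<exists>u v. P = {u, v} \<and> d = \<bar>int (num_closer G u v) - int (num_closer G v u)\<bar>)"

lemma pair_imbalance_doubleton:
  "pair_imbalance G {u, v} = \<bar>int (num_closer G u v) - int (num_closer G v u)\<bar>"
  unfolding pair_imbalance_def
  by (rule the_equality) (auto simp: doubleton_eq_iff)

definition uB :: "'a pair_pre_digraph \<Rightarrow> int" where
  "uB G = (\<Sum>P \<in> {P. P \<subseteq> pverts G \<and> card P = 2}. pair_imbalance G P)"

text \<open>
  The leg with index \<open>i\<close> is the path replacing the edge \<open>e\<^sub>i\<close> of the star: its vertices are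
  \<open>leg_vertex i 0, \<dots>, leg_vertex i (ns ! i)\<close> in this order, and \<open>leg_vertex i 0\<close> is the center
  \<open>(0, 0)\<close>, which all the legs share.  Legs are numbered from 0.
\<close>

definition leg_vertex :: "nat \<Rightarrow> nat \<Rightarrow> nat \<times> nat" where
  "leg_vertex i j = (if j = 0 then (0, 0) else (i, j))"

definition subdivided_star :: "nat list \<Rightarrow> (nat \<times> nat) pair_pre_digraph" where
  "subdivided_star ns =
     \<lparr> pverts = insert (0, 0) {leg_vertex i j | i j. i < length ns \<and> j \<le> ns ! i},
       parcs = symcl {(leg_vertex i j, leg_vertex i (Suc j)) | i j. i < length ns \<and> j < ns ! i} \<rparr>"

lemma pverts_subdivided_star:
  "pverts (subdivided_star ns) = insert (0, 0) (SIGMA i:{..<length ns}. {1..ns ! i})"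
proof (intro set_eqI iffI)
  fix x assume "x \<in> pverts (subdivided_star ns)"
  then show "x \<in> insert (0, 0) (SIGMA i:{..<length ns}. {1..ns ! i})"
    by (auto simp: subdivided_star_def leg_vertex_def split: if_splits)
next
  fix x assume "x \<in> insert (0, 0) (SIGMA i:{..<length ns}. {1..ns ! i})"
  then consider "x = (0, 0)"
    | i j where "x = leg_vertex i j" "i < length ns" "j \<le> ns ! i"
    by (fastforce simp: leg_vertex_def)
  then show "x \<in> pverts (subdivided_star ns)"
    by cases (auto simp: subdivided_star_def)
qed

lemma sym_symcl: "sym (symcl R)"
  by (auto simp: symcl_def sym_def)

lemma pair_graph_subdivided_star: "pair_graph (subdivided_star ns)"
proof -
  have fin: "finite (pverts (subdivided_star ns))"
    by (simp add: pverts_subdivided_star)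
  have sub: "parcs (subdivided_star ns) \<subseteq> pverts (subdivided_star ns) \<times> pverts (subdivided_star ns)"
  proof
    fix e assume "e \<in> parcs (subdivided_star ns)"
    then obtain i j where "i < length ns" "j < ns ! i"
      and "e = (leg_vertex i j, leg_vertex i (Suc j)) \<or> e = (leg_vertex i (Suc j), leg_vertex i j)"
      by (auto simp: subdivided_star_def symcl_def)
    then show "e \<in> pverts (subdivided_star ns) \<times> pverts (subdivided_star ns)"
      by (cases j) (auto simp: pverts_subdivided_star leg_vertex_def)
  qed
  show ?thesis
  proof unfold_locales
    show "finite (parcs (subdivided_star ns))"
      by (rule finite_subset[OF sub]) (intro finite_cartesian_product fin)
    show "symmetric (with_proj (subdivided_star ns))"
      unfolding symmetric_def subdivided_star_def
      by (simp add: sym_symcl)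
    fix e assume e: "e \<in> parcs (subdivided_star ns)"
    show "fst e \<in> pverts (subdivided_star ns)" "snd e \<in> pverts (subdivided_star ns)"
      using subsetD[OF sub e] by (simp_all add: mem_Times_iff)
    show "fst e \<noteq> snd e"
      using e by (auto simp: subdivided_star_def symcl_def leg_vertex_def split: if_splits)
  qed (rule fin)
qed

lemma card_pverts_subdivided_star:
  "card (pverts (subdivided_star ns)) = 1 + sum_list ns"
  by (simp add: pverts_subdivided_star sum_list_sum_nth atLeast0LessThan)

end

theory Submission
  imports Defs
begin

text \<open>
  Let \<open>m = n - 1\<close> be the number of vertices other than the center and let \<open>a\<^sub>1, \<dots>, a\<^sub>k\<close> be the
  lengths of the legs, so that they sum to \<open>m\<close>.  Take two vertices at distances \<open>x < y\<close> from the
  center, the farther one on leg \<open>j\<close>.  The vertices closer to it are the outer part of leg \<open>j\<close>,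
  beyond the middle of the path that joins the two, and all other vertices, up to one possible
  middle vertex, are closer to the other end.  Counting gives an imbalance of exactly
  \<open>\<bar>m - 2 a\<^sub>j + s\<bar>\<close>, where \<open>s\<close> is \<open>y - x\<close> for different legs and \<open>x + y\<close> for the same leg
  (\<open>imbalance_legs\<close>).  Pairs with the center and pairs with \<open>x = y\<close> contribute only \<open>O(k m\<^sup>2)\<close> in
  total.

  Dropping the absolute values and summing gives, for twice the unbalancedness and up to
  \<open>O(k m\<^sup>2)\<close>, the cubic form (\<open>star_cubic\<close>)

  \<open>\<Phi>(a) = m\<^sup>3 - m \<Sum>\<^sub>i a\<^sub>i\<^sup>2 - 1/3 \<Sum>\<^sub>i\<^sub>\<noteq>\<^sub>j h(a\<^sub>i, a\<^sub>j)\<close>, where \<open>h(a, b) = a\<^sup>3 + b\<^sup>3 - \<bar>a - b\<bar>\<^sup>3\<close>.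

  The absolute values matter only if a leg is longer than half of \<open>m\<close>.  If \<open>c\<^sub>i\<close> is
  \<open>max 0 (2 a\<^sub>i - m)\<close>, then they add at most \<open>\<Sum>\<^sub>i (c\<^sub>i\<^sup>3/3 + 2 (m - a\<^sub>i) c\<^sub>i\<^sup>2)\<close> to leading order
  (\<open>two_uB_star_cubic_bounds\<close>).

  It remains to maximize a function of \<open>k\<close> nonnegative real numbers with sum \<open>m\<close>.  At equal legs
  \<open>a\<^sub>i = m/k\<close> all \<open>c\<^sub>i\<close> vanish and \<open>\<Phi>\<close> equals \<open>(1 - 1/k) (1 - 2/(3k)) m\<^sup>3\<close>, which is twice the
  claimed leading term.  This is the maximum.

  If no leg exceeds \<open>m/2\<close>, the reason is an inequality for two numbers: \<open>h\<close> lies above its tangent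
  plane at \<open>(m/k, m/k)\<close> minus a multiple of the squared deviations from \<open>m/k\<close>
  (\<open>cube_defect_lower\<close>).  Summed over all pairs, the linear terms add up to a constant, and the
  quadratic loss is paid for by the term \<open>- m \<Sum>\<^sub>i a\<^sub>i\<^sup>2\<close> (\<open>star_cubic_le_balanced\<close>).

  If a leg exceeds \<open>m/2\<close>, let \<open>t\<close> be the total length of the others.  The corrected form is at most
  \<open>m\<^sup>3/3 + 4/3 (t\<^sup>3 - \<Sum> a\<^sub>j\<^sup>3)\<close>, the sum being over the other legs.  For \<open>k = 2\<close> this is \<open>m\<^sup>3/3\<close>, which
  is the maximum: all subdivided stars with two legs and the same order are the same path.  For
  \<open>k \<ge> 3\<close> it is at most \<open>m\<^sup>3/2\<close>, because \<open>t \<le> m/2\<close>, and that is below the value at equal legs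
  (\<open>star_cubic_long_leg_le_balanced\<close>).

  Finally, legs whose lengths are \<open>m/k\<close> rounded up or down come within \<open>O(m\<^sup>2)\<close> of the maximum of \<open>\<Phi>\<close>
  (\<open>balanced_le_star_cubic\<close>), and \<open>\<Phi>\<close> without correction is a lower bound because a
  number is at most its absolute value.
\<close>

section \<open>Distances in a subdivided star\<close>

text \<open>
  A function that vanishes at the source and grows by at most one along each arc bounds every walk
  length from below.  If every other vertex also has a neighbour where the function is smaller by
  one, then descending along such neighbours gives a walk of that length.
\<close>

lemma graph_dist_eqI:
  fixes d :: "'a \<Rightarrow> nat"
  assumes "pair_graph G" and "s \<in> pverts G" "v \<in> pverts G"
    and d_source: "d s = 0"
    and d_step: "\<And>x y. (x, y) \<in> parcs G \<Longrightarrow> d y \<le> d x + 1"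
    and d_pred: "\<And>y. y \<in> pverts G \<Longrightarrow> y \<noteq> s \<Longrightarrow> \<exists>x. (x, y) \<in> parcs G \<and> d y = d x + 1"
  shows "graph_dist G s v = ereal (real (d v))"
proof -
  interpret pair_graph G by fact
  have lower: "real (d y) \<le> real (d x) + awalk_cost (\<lambda>_. 1) p" if "awalk x p y" for x p y
    using that
  proof (induction p arbitrary: x)
    case Nil
    then show ?case by (simp add: awalk_Nil_iff)
  next
    case (Cons e p)
    then have e: "e \<in> parcs G" "fst e = x" and p: "awalk (snd e) p y"
      by (auto simp: awalk_Cons_iff)
    then have "d (snd e) \<le> d x + 1"
      using d_step[of "fst e" "snd e"] by (cases e) simp
    with Cons.IH[OF p] show ?case by simp
  qed
  have "graph_dist G s v \<le> ereal (real (d v))"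
    using \<open>v \<in> pverts G\<close>
  proof (induction "d v" arbitrary: v)
    case 0
    then have "v = s"
      using d_pred by fastforce
    moreover have "awalk s [] s"
      using \<open>s \<in> pverts G\<close> by (simp add: awalk_Nil_iff)
    ultimately show ?case
      using min_cost_le_walk_cost[of s "[]" s "\<lambda>_. 1"] 0 d_source
      by (simp add: graph_dist_def zero_ereal_def)
  next
    case (Suc n)
    then have "v \<noteq> s" using d_source by auto
    then obtain x where x: "(x, v) \<in> parcs G" "d v = d x + 1"
      using d_pred Suc.prems by blast
    then have "x \<in> pverts G"
      using in_arcsD1 by auto
    with x Suc have "graph_dist G s x \<le> ereal (real (d x))" by simp
    moreover have "graph_dist G s v \<le> graph_dist G s x + 1"
      using pos_cost_mu_triangle[of "\<lambda>_. 1" "(x, v)" x v s] x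
      by (simp add: graph_dist_def arc_to_ends_def one_ereal_def)
    ultimately have "graph_dist G s v \<le> ereal (real (d x)) + 1"
      by (meson add_right_mono order_trans)
    then show ?case using x by (simp add: one_ereal_def add.commute)
  qed
  moreover have "ereal (real (d v)) \<le> graph_dist G s v"
    unfolding graph_dist_def \<mu>_def
    by (rule INF_greatest) (use lower d_source in fastforce)
  ultimately show ?thesis by (rule antisym)
qed

definition star_dist :: "nat \<times> nat \<Rightarrow> nat \<times> nat \<Rightarrow> nat" where
  "star_dist u w =
     (if fst u = fst w then (if snd u \<le> snd w then snd w - snd u else snd u - snd w)
      else snd u + snd w)"

lemma star_dist_centre: "star_dist u (0, 0) = snd u"
  by (simp add: star_dist_def)

text \<open>
  The center is stored as \<open>(0, 0)\<close>, but for distances it may be treated as the vertex number 0 of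
  every leg.
\<close>

lemma star_dist_leg_vertex: "star_dist u (leg_vertex i j) = star_dist u (i, j)"
  by (simp add: star_dist_def leg_vertex_def)

lemma star_dist_Suc:
  "star_dist u (i, j) \<le> star_dist u (i, Suc j) + 1"
  "star_dist u (i, Suc j) \<le> star_dist u (i, j) + 1"
  by (simp_all add: star_dist_def) arith+

lemma graph_dist_subdivided_star:
  assumes u: "u \<in> pverts (subdivided_star ns)" and w: "w \<in> pverts (subdivided_star ns)"
  shows "graph_dist (subdivided_star ns) u w = ereal (real (star_dist u w))"
proof (rule graph_dist_eqI[OF pair_graph_subdivided_star u w])
  show "star_dist u u = 0"
    by (simp add: star_dist_def)
next
  fix x y
  assume "(x, y) \<in> parcs (subdivided_star ns)"
  then show "star_dist u y \<le> star_dist u x + 1"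
    using star_dist_Suc[of u]
    by (auto simp: subdivided_star_def symcl_def star_dist_leg_vertex
        simp del: split_paired_All split_paired_Ex)
next
  fix y
  assume y: "y \<in> pverts (subdivided_star ns)" "y \<noteq> u"
  obtain i a where [simp]: "u = (i, a)" by fastforce
  obtain j b where [simp]: "y = (j, b)" by fastforce
  have symclI: "(p, q) \<in> symcl R \<and> (q, p) \<in> symcl R" if "(p, q) \<in> R"
    for p q :: "nat \<times> nat" and R
    using that by (force simp: symcl_def)
  have arcI: "(leg_vertex l c, leg_vertex l (Suc c)) \<in> parcs (subdivided_star ns)
      \<and> (leg_vertex l (Suc c), leg_vertex l c) \<in> parcs (subdivided_star ns)"
    if "l < length ns" "c < ns ! l" for l c
  proof -
    have "(leg_vertex l c, leg_vertex l (Suc c))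
        \<in> {(leg_vertex i j, leg_vertex i (Suc j)) | i j. i < length ns \<and> j < ns ! i}"
      using that by blast
    from symclI[OF this] show ?thesis
      by (simp add: subdivided_star_def)
  qed
  have ua: "(i = 0 \<and> a = 0) \<or> (i < length ns \<and> 1 \<le> a \<and> a \<le> ns ! i)"
    using u by (auto simp: pverts_subdivided_star)
  have yb: "(j = 0 \<and> b = 0) \<or> (j < length ns \<and> 1 \<le> b \<and> b \<le> ns ! j)"
    using y by (auto simp: pverts_subdivided_star)
  \<comment> \<open>Towards \<open>u\<close> one moves outwards on the leg of \<open>u\<close> below \<open>u\<close>, and inwards elsewhere.\<close>
  show "\<exists>x. (x, y) \<in> parcs (subdivided_star ns) \<and> star_dist u y = star_dist u x + 1"
  proof (cases "b < a \<and> (b = 0 \<or> i = j)")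
    case True
    then have "(leg_vertex i (Suc b), leg_vertex i b) \<in> parcs (subdivided_star ns)"
      using arcI ua by auto
    moreover have "leg_vertex i b = y"
      using True yb by (auto simp: leg_vertex_def)
    moreover have "star_dist u (leg_vertex i b) = star_dist u (leg_vertex i (Suc b)) + 1"
      using True by (simp add: star_dist_leg_vertex) (auto simp: star_dist_def)
    ultimately show ?thesis by metis
  next
    case False
    then have b: "b > 0"
      using y ua yb by auto
    then have "(leg_vertex j (b - 1), leg_vertex j b) \<in> parcs (subdivided_star ns)"
      using arcI[of j "b - 1"] yb by auto
    moreover have "leg_vertex j b = y"
      using b by (auto simp: leg_vertex_def)
    moreover have "star_dist u (leg_vertex j b) = star_dist u (leg_vertex j (b - 1)) + 1"
      using False b y by (simp add: star_dist_leg_vertex) (auto simp: star_dist_def)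
    ultimately show ?thesis by metis
  qed
qed

lemma num_closer_subdivided_star:
  assumes "u \<in> pverts (subdivided_star ns)" and "v \<in> pverts (subdivided_star ns)"
  shows "num_closer (subdivided_star ns) u v =
    card {w \<in> pverts (subdivided_star ns). star_dist u w < star_dist v w}"
  unfolding num_closer_def using assms
  by (intro arg_cong[where f = card]) (auto simp: graph_dist_subdivided_star)

section \<open>Imbalance of a pair of vertices\<close>

definition imbalance :: "'a pair_pre_digraph \<Rightarrow> 'a \<Rightarrow> 'a \<Rightarrow> int" where
  "imbalance G u v = \<bar>int (num_closer G u v) - int (num_closer G v u)\<bar>"

lemma imbalance_commute: "imbalance G u v = imbalance G v u"
  by (simp add: imbalance_def)

lemma imbalance_self: "imbalance G u u = 0"
  by (simp add: imbalance_def)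

lemma imbalance_nonneg: "0 \<le> imbalance G u v"
  by (simp add: imbalance_def)

lemma imbalance_le_card:
  assumes "finite (pverts G)"
  shows "imbalance G u v \<le> int (card (pverts G))"
proof -
  have "num_closer G x y \<le> card (pverts G)" for x y
    unfolding num_closer_def using assms by (intro card_mono) auto
  from this[of u v] this[of v u] show ?thesis
    by (simp add: imbalance_def)
qed

text \<open>
  Every unordered pair arises from two ordered ones.  Ordered pairs make it possible to sum over
  legs and over positions on the legs independently.
\<close>

lemma two_uB_eq_ordered_sum:
  assumes fin: "finite (pverts G)"
  shows "2 * uB G = (\<Sum>u\<in>pverts G. \<Sum>v\<in>pverts G. imbalance G u v)"
proof -
  define V where "V = pverts G"
  define A where "A = {p \<in> V \<times> V. fst p \<noteq> snd p}"
  define B where "B = {P. P \<subseteq> V \<and> card P = 2}"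
  have finV: "finite V" using fin by (simp add: V_def)
  have "(\<Sum>u\<in>V. \<Sum>v\<in>V. imbalance G u v) = (\<Sum>(u, v)\<in>V \<times> V. imbalance G u v)"
    by (rule sum.cartesian_product)
  also have "\<dots> = (\<Sum>(u, v)\<in>A. imbalance G u v)"
    using finV by (intro sum.mono_neutral_right) (auto simp: A_def imbalance_def)
  also have "\<dots> = (\<Sum>P\<in>B. \<Sum>(u, v)\<in>{p \<in> A. {fst p, snd p} = P}. imbalance G u v)"
    using finV by (intro sum.group[symmetric]) (auto simp: A_def B_def)
  also have "\<dots> = (\<Sum>P\<in>B. 2 * pair_imbalance G P)"
  proof (rule sum.cong[OF refl])
    fix P assume "P \<in> B"
    then obtain u v where P: "P = {u, v}" "u \<noteq> v" "u \<in> V" "v \<in> V"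
      by (auto simp: B_def card_2_iff)
    then have "{p \<in> A. {fst p, snd p} = P} = {(u, v), (v, u)}"
      by (auto simp: A_def doubleton_eq_iff)
    with P show "(\<Sum>(u, v)\<in>{p \<in> A. {fst p, snd p} = P}. imbalance G u v) = 2 * pair_imbalance G P"
      by (simp add: pair_imbalance_doubleton imbalance_def)
  qed
  finally show ?thesis
    by (simp add: uB_def V_def B_def sum_distrib_left)
qed

text \<open>
  With \<open>s\<close> the last term on the right-hand side, a vertex is closer to \<open>(j, y)\<close> exactly if it is a
  vertex \<open>(j, z)\<close> with \<open>s < 2 z\<close>, and equidistant exactly if it is such a vertex with
  \<open>s = 2 z\<close>.  The latter occurs for even \<open>s\<close> only, and this parity term cancels the rounding of
  \<open>s div 2\<close>, so that the formula has no error term.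
\<close>

lemma imbalance_legs:
  assumes i: "i < length ns" "1 \<le> x" "x \<le> ns ! i"
    and j: "j < length ns" "1 \<le> y" "y \<le> ns ! j" and "x < y"
  shows "imbalance (subdivided_star ns) (i, x) (j, y)
    = \<bar>int (sum_list ns) - 2 * int (ns ! j) + (if i = j then int x + int y else int y - int x)\<bar>"
proof -
  define V where "V = pverts (subdivided_star ns)"
  define s where "s = (if i = j then x + y else y - x)"
  define closer_u where "closer_u = {w \<in> V. star_dist (i, x) w < star_dist (j, y) w}"
  define closer_v where "closer_v = {w \<in> V. star_dist (j, y) w < star_dist (i, x) w}"
  define middle where "middle = {w \<in> V. star_dist (j, y) w = star_dist (i, x) w}"
  have V: "V = insert (0, 0) (SIGMA i:{..<length ns}. {1..ns ! i})"
    by (simp add: V_def pverts_subdivided_star)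
  have finV: "finite V" by (simp add: V)
  have s: "1 \<le> s" "s < 2 * ns ! j"
    using assms by (auto simp: s_def)
  have closer: "star_dist (j, y) (l, z) < star_dist (i, x) (l, z) \<longleftrightarrow> l = j \<and> s < 2 * z"
    and equal: "star_dist (j, y) (l, z) = star_dist (i, x) (l, z) \<longleftrightarrow> l = j \<and> s = 2 * z"
    if "(l, z) \<in> V" for l z
  proof -
    have "(star_dist (j, y) (l, z) < star_dist (i, x) (l, z) \<longleftrightarrow> l = j \<and> s < 2 * z)
        \<and> (star_dist (j, y) (l, z) = star_dist (i, x) (l, z) \<longleftrightarrow> l = j \<and> s = 2 * z)"
    proof (cases "z = 0")
      case True
      with that have "l = 0" by (auto simp: V)
      with True s \<open>x < y\<close> show ?thesis by (simp add: star_dist_centre)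
    next
      case False
      show ?thesis
      proof (cases "l = j")
        case True
        with False \<open>x < y\<close> i j show ?thesis
          by (cases "i = j"; simp add: star_dist_def s_def; linarith)
      next
        case l: False
        with False \<open>x < y\<close> i j show ?thesis
          by (cases "i = l"; simp add: star_dist_def; linarith)
      qed
    qed
    then show "star_dist (j, y) (l, z) < star_dist (i, x) (l, z) \<longleftrightarrow> l = j \<and> s < 2 * z"
      and "star_dist (j, y) (l, z) = star_dist (i, x) (l, z) \<longleftrightarrow> l = j \<and> s = 2 * z"
      by auto
  qed
  have half: "s < 2 * z \<longleftrightarrow> s div 2 + 1 \<le> z" for z by linarith
  have "closer_v = {w \<in> V. fst w = j \<and> s < 2 * snd w}"
    using closer by (auto simp: closer_v_def)
  then have closer_v: "closer_v = Pair j ` {s div 2 + 1..ns ! j}"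
    using j by (auto simp: V half)
  have "middle = {w \<in> V. fst w = j \<and> s = 2 * snd w}"
    using equal by (auto simp: middle_def)
  then have middle: "middle = (if even s then {(j, s div 2)} else {})"
    using s j by (auto simp: V elim!: evenE)
  have "card V = card closer_u + (card closer_v + card middle)"
  proof -
    have "V = closer_u \<union> (closer_v \<union> middle)"
      by (auto simp: closer_u_def closer_v_def middle_def)
    moreover have "finite closer_u" "finite closer_v" "finite middle"
      using finV by (simp_all add: closer_u_def closer_v_def middle_def)
    moreover have "closer_u \<inter> (closer_v \<union> middle) = {}" "closer_v \<inter> middle = {}"
      by (auto simp: closer_u_def closer_v_def middle_def)
    ultimately show ?thesis by (metis card_Un_disjoint finite_UnI)
  qed
  moreover have "card V = 1 + sum_list ns"
    by (simp add: V_def card_pverts_subdivided_star)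
  moreover have "int (card closer_v) = int (ns ! j) - int (s div 2)"
    using s by (subst closer_v) (simp add: card_image inj_on_def of_nat_diff)
  moreover have "int (card middle) = 1 - int s + 2 * int (s div 2)"
    unfolding middle by (auto elim!: evenE oddE)
  ultimately have "int (card closer_u) - int (card closer_v)
      = int (sum_list ns) - 2 * int (ns ! j) + int s"
    by linarith
  moreover have "(i, x) \<in> V" "(j, y) \<in> V"
    using i j by (auto simp: V)
  ultimately show ?thesis
    using \<open>x < y\<close>
    by (simp add: imbalance_def num_closer_subdivided_star s_def of_nat_diff
        flip: V_def closer_u_def closer_v_def)
qed

section \<open>The cubic form of the leg lengths and its maximum\<close>

text \<open>
  This is six times the integral of \<open>\<bar>s - t\<bar>\<close> over \<open>s \<in> [0, a]\<close> and \<open>t \<in> [0, b]\<close>; it enters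
  through the sum of the distance differences over the pairs of vertices of two legs.
\<close>

definition cube_defect :: "real \<Rightarrow> real \<Rightarrow> real" where
  "cube_defect a b = a ^ 3 + b ^ 3 - \<bar>a - b\<bar> ^ 3"

lemma cube_defect_commute: "cube_defect a b = cube_defect b a"
  by (simp add: cube_defect_def abs_minus_commute)

lemma cube_defect_le: "b \<le> a \<Longrightarrow> cube_defect a b = 3 * a\<^sup>2 * b - 3 * a * b\<^sup>2 + 2 * b ^ 3"
  by (simp add: cube_defect_def algebra_simps power2_eq_square power3_eq_cube)

lemma cube_defect_nonneg:
  assumes "0 \<le> a" "0 \<le> b"
  shows "0 \<le> cube_defect a b"
proof -
  have "\<bar>a - b\<bar> ^ 3 \<le> (max a b) ^ 3"
    using assms by (intro power_mono) auto
  also have "\<dots> \<le> a ^ 3 + b ^ 3"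
    using assms by (simp add: max_def)
  finally show ?thesis by (simp add: cube_defect_def)
qed

lemma cube_defect_upper:
  assumes "0 \<le> a" "a \<le> c" "0 \<le> b" "b \<le> c"
  shows "cube_defect a b \<le> 2 * c ^ 3"
proof -
  have "a ^ 3 \<le> c ^ 3" "b ^ 3 \<le> c ^ 3"
    using assms by (simp_all add: power_mono)
  moreover have "0 \<le> \<bar>a - b\<bar> ^ 3"
    by simp
  ultimately show ?thesis unfolding cube_defect_def by linarith
qed

text \<open>
  For fixed \<open>b\<close> the right-hand side is a quadratic polynomial in \<open>a\<close> with a positive leading
  coefficient, and its negated discriminant is \<open>(b - 1)\<^sup>2 (15 b\<^sup>2 + 60 b + 6)\<close>.  Equality holds at
  \<open>a = b = 1\<close>.
\<close>

lemma cube_defect_lower_unit: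
  fixes a b :: real
  assumes "0 \<le> b" "b \<le> a"
  shows "0 \<le> 3 * a\<^sup>2 * b - 3 * a * b\<^sup>2 + 2 * b ^ 3
    - 3 * (a + b) + 4 + 3/2 * ((a - 1)\<^sup>2 + (b - 1)\<^sup>2)" (is "0 \<le> ?p")
proof -
  have "4 * (3 * b + 3/2) * ?p =
      (2 * (3 * b + 3/2) * a - (3 * b\<^sup>2 + 6))\<^sup>2 + (b - 1)\<^sup>2 * (15 * b\<^sup>2 + 60 * b + 6)"
    by (simp add: power2_eq_square power3_eq_cube algebra_simps)
  also have "\<dots> \<ge> 0"
    using assms by (intro add_nonneg_nonneg mult_nonneg_nonneg) auto
  finally show ?thesis
    using assms by (simp add: zero_le_mult_iff)
qed

text \<open>
  The first two terms are the tangent plane at \<open>(s, s)\<close>.  The function is not convex, so a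
  quadratic term must be subtracted; the factor \<open>3/2\<close> is what \<open>star_cubic_le_balanced\<close> can afford.
\<close>

lemma cube_defect_lower:
  assumes "0 \<le> a" "0 \<le> b" "0 < s"
  shows "3 * s\<^sup>2 * (a + b) - 4 * s ^ 3 - 3/2 * s * ((a - s)\<^sup>2 + (b - s)\<^sup>2) \<le> cube_defect a b"
  using assms(1,2)
proof (induction a b rule: linorder_wlog)
  case (sym a b)
  then show ?case by (simp add: cube_defect_commute algebra_simps)
next
  case (le b a)
  have "0 \<le> s ^ 3 * (3 * (a/s)\<^sup>2 * (b/s) - 3 * (a/s) * (b/s)\<^sup>2 + 2 * (b/s) ^ 3
    - 3 * (a/s + b/s) + 4 + 3/2 * ((a/s - 1)\<^sup>2 + (b/s - 1)\<^sup>2))"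
    using le \<open>0 < s\<close> by (intro mult_nonneg_nonneg cube_defect_lower_unit)
      (auto simp: divide_right_mono)
  also have "\<dots> = cube_defect a b - (3 * s\<^sup>2 * (a + b) - 4 * s ^ 3 - 3/2 * s * ((a - s)\<^sup>2 + (b - s)\<^sup>2))"
    using \<open>0 < s\<close> le by (simp add: cube_defect_le field_simps power2_eq_square power3_eq_cube)
  finally show ?case by (simp add: cube_defect_commute add.commute)
qed

text \<open>
  The factor of \<open>n\<^sup>3\<close> in the leading term of twice the unbalancedness, for legs of equal length.
\<close>

definition balanced_value :: "nat \<Rightarrow> real" where
  "balanced_value k = 1 - 5 / (3 * real k) + 2 / (3 * (real k)\<^sup>2)"

definition star_cubic :: "nat \<Rightarrow> (nat \<Rightarrow> real) \<Rightarrow> real" where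
  "star_cubic k a = (let m = \<Sum>i<k. a i in
     m ^ 3 - m * (\<Sum>i<k. (a i)\<^sup>2) - (\<Sum>i<k. \<Sum>j\<in>{..<k} - {i}. cube_defect (a i) (a j)) / 3)"

text \<open>
  If a leg is longer than half of the total, the sign of \<open>m - 2 a\<^sub>i + s\<close> is negative for small
  \<open>s\<close>, and the excess is the range of \<open>s\<close> where this happens.
\<close>

definition leg_excess :: "nat \<Rightarrow> (nat \<Rightarrow> real) \<Rightarrow> nat \<Rightarrow> real" where
  "leg_excess k a i = max 0 (2 * a i - (\<Sum>j<k. a j))"

text \<open>
  The bound \<open>cube_defect_lower\<close> is applied to all pairs with \<open>s\<close> the mean length.  Since the
  deviations from the mean sum to zero, the tangent planes contribute a constant.  The quadratic
  terms cost \<open>s (k - 1) V\<close>, where \<open>V\<close> is the sum of the squared deviations, while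
  \<open>m \<Sum>\<^sub>i a\<^sub>i\<^sup>2\<close> contains \<open>m V = s k V\<close>.
\<close>

lemma star_cubic_le_balanced:
  assumes k: "2 \<le> k" and nonneg: "\<And>i. i < k \<Longrightarrow> 0 \<le> a i" and pos: "0 < (\<Sum>i<k. a i)"
  shows "star_cubic k a \<le> balanced_value k * (\<Sum>i<k. a i) ^ 3"
proof -
  define m where "m = (\<Sum>i<k. a i)"
  define Q where "Q = (\<Sum>i<k. (a i)\<^sup>2)"
  define s where "s = m / real k"
  define V where "V = (\<Sum>i<k. (a i - s)\<^sup>2)"
  have k0: "real k \<ge> 2" using k by simp
  have s: "s > 0" and m: "m = real k * s"
    using pos k0 by (simp_all add: s_def m_def)
  have V: "V = Q - real k * s\<^sup>2"
  proof -
    have "V = Q - 2 * s * m + real k * s\<^sup>2"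
      by (simp add: V_def Q_def m_def power2_diff sum.distrib sum_subtractf sum_distrib_left
          algebra_simps)
    then show ?thesis by (simp add: m power2_eq_square)
  qed
  have "V \<ge> 0" by (simp add: V_def sum_nonneg)
  define L where "L = (\<Sum>i<k. \<Sum>j\<in>{..<k} - {i}.
      3 * s\<^sup>2 * (a i + a j) - 4 * s ^ 3 - 3/2 * s * ((a i - s)\<^sup>2 + (a j - s)\<^sup>2))"
  have inner: "(\<Sum>j\<in>{..<k} - {i}.
      3 * s\<^sup>2 * (a i + a j) - 4 * s ^ 3 - 3/2 * s * ((a i - s)\<^sup>2 + (a j - s)\<^sup>2))
      = 3 * s\<^sup>2 * ((real k - 2) * a i + m) - 4 * (real k - 1) * s ^ 3
        - 3/2 * s * ((real k - 2) * (a i - s)\<^sup>2 + V)" if "i < k" for i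
  proof -
    have "(\<Sum>j<k. 3 * s\<^sup>2 * (a i + a j) - 4 * s ^ 3 - 3/2 * s * ((a i - s)\<^sup>2 + (a j - s)\<^sup>2))
      = 3 * s\<^sup>2 * (real k * a i + m) - 4 * real k * s ^ 3
        - 3/2 * s * (real k * (a i - s)\<^sup>2 + V)"
    proof -
      have "(\<Sum>j<k. (a i - s)\<^sup>2 + (a j - s)\<^sup>2) = real k * (a i - s)\<^sup>2 + V"
        and "(\<Sum>j<k. a i + a j) = real k * a i + m"
        by (simp_all add: m_def V_def sum.distrib)
      then show ?thesis
        by (simp add: sum_subtractf sum.distrib del: times_divide_eq_left flip: sum_distrib_left)
    qed
    with that show ?thesis
      by (simp add: sum_diff1 algebra_simps)
  qed
  have "L = (\<Sum>i<k. 3 * s\<^sup>2 * ((real k - 2) * a i + m) - 4 * (real k - 1) * s ^ 3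
        - 3/2 * s * ((real k - 2) * (a i - s)\<^sup>2 + V))"
    unfolding L_def using inner by simp
  also have "\<dots> = 3 * s\<^sup>2 * ((real k - 2) * m + real k * m) - 4 * real k * (real k - 1) * s ^ 3
        - 3/2 * s * ((real k - 2) * V + real k * V)"
  proof -
    have "(\<Sum>i<k. (real k - 2) * a i + m) = (real k - 2) * m + real k * m"
      and "(\<Sum>i<k. (real k - 2) * (a i - s)\<^sup>2 + V) = (real k - 2) * V + real k * V"
      by (simp_all add: m_def V_def sum.distrib flip: sum_distrib_left)
    then show ?thesis
      by (simp only: sum_subtractf sum_distrib_left[symmetric]) simp
  qed
  finally have L: "L = 2 * real k * (real k - 1) * s ^ 3 - 3 * s * (real k - 1) * V"
    by (simp add: m power2_eq_square power3_eq_cube algebra_simps)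
  have "L \<le> (\<Sum>i<k. \<Sum>j\<in>{..<k} - {i}. cube_defect (a i) (a j))"
    unfolding L_def using nonneg s by (intro sum_mono cube_defect_lower) auto
  then have "star_cubic k a \<le> m ^ 3 - m * Q - L / 3"
    by (simp add: star_cubic_def Let_def m_def Q_def)
  also have "\<dots> = s ^ 3 * real k * (real k - 1) * (real k - 2/3) - s * V"
    unfolding L V by (simp add: m power2_eq_square power3_eq_cube field_simps)
  also have "\<dots> \<le> s ^ 3 * real k * (real k - 1) * (real k - 2/3)"
    using s \<open>V \<ge> 0\<close> by simp
  also have "\<dots> = balanced_value k * m ^ 3"
    using k0 by (simp add: balanced_value_def m field_simps power2_eq_square power3_eq_cube)
  finally show ?thesis by (simp add: m_def)
qed

text \<open>
  Of all the pairs of legs, only those with the long leg are needed.  They bound the left-hand side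
  by \<open>m\<^sup>3/3 + 4/3 (t\<^sup>3 - B3)\<close>, where \<open>t\<close> and \<open>B3\<close> are the sums of the lengths and of their cubes
  over the other legs.  The bound is attained for two legs, so \<open>k = 2\<close> leaves no room for
  estimates; for \<open>k \<ge> 3\<close> it is enough that \<open>t \<le> m/2\<close>.
\<close>

lemma star_cubic_long_leg_le_balanced:
  assumes k: "2 \<le> k" and nonneg: "\<And>i. i < k \<Longrightarrow> 0 \<le> a i"
    and l: "l < k" "(\<Sum>i<k. a i) \<le> 2 * a l"
  defines "m \<equiv> \<Sum>i<k. a i"
  defines "c \<equiv> 2 * a l - m"
  shows "star_cubic k a + (c ^ 3 / 3 + 2 * (m - a l) * c\<^sup>2) \<le> balanced_value k * m ^ 3"
proof -
  define I where "I = {..<k} - {l}"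
  define t where "t = (\<Sum>j\<in>I. a j)"
  define B2 where "B2 = (\<Sum>j\<in>I. (a j)\<^sup>2)"
  define B3 where "B3 = (\<Sum>j\<in>I. (a j) ^ 3)"
  have finI: "finite I" by (simp add: I_def)
  have Ik: "j < k" "j \<noteq> l" if "j \<in> I" for j
    using that by (auto simp: I_def)
  have I0: "0 \<le> a j" if "j \<in> I" for j
    using nonneg Ik that by blast
  have split_l: "(\<Sum>i<k. f i) = f l + (\<Sum>i\<in>I. f i)" for f :: "nat \<Rightarrow> real"
    unfolding I_def using l by (intro sum.remove) auto
  have m: "m = a l + t"
    by (simp add: m_def t_def split_l)
  have c: "c = a l - t" "0 \<le> c"
    using l by (simp_all add: c_def m flip: m_def)
  have t: "0 \<le> t" "0 \<le> m"
    using I0 nonneg l by (auto simp: t_def m_def intro!: sum_nonneg)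
  have le_t: "a j \<le> t" if "j \<in> I" for j
    unfolding t_def using finI that I0 by (intro member_le_sum) auto
  have "B2 \<le> t\<^sup>2"
  proof -
    have "B2 \<le> (\<Sum>j\<in>I. t * a j)"
      unfolding B2_def power2_eq_square using le_t I0
      by (intro sum_mono mult_right_mono) auto
    then show ?thesis by (simp add: t_def power2_eq_square sum_distrib_left)
  qed
  have B3: "0 \<le> B3" using I0 by (auto simp: B3_def intro!: sum_nonneg)
  have "(\<Sum>j\<in>I. cube_defect (a l) (a j)) = 3 * (a l)\<^sup>2 * t - 3 * a l * B2 + 2 * B3"
  proof -
    have "cube_defect (a l) (a j) = 3 * (a l)\<^sup>2 * a j - 3 * a l * (a j)\<^sup>2 + 2 * (a j) ^ 3"
      if "j \<in> I" for j
      using le_t[OF that] c by (intro cube_defect_le) auto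
    then show ?thesis
      by (simp add: t_def B2_def B3_def sum.distrib sum_subtractf sum_distrib_left)
  qed
  moreover have "(\<Sum>i<k. \<Sum>j\<in>{..<k} - {i}. cube_defect (a i) (a j))
      \<ge> 2 * (\<Sum>j\<in>I. cube_defect (a l) (a j))"
  proof -
    have "cube_defect (a i) (a l) \<le> (\<Sum>j\<in>{..<k} - {i}. cube_defect (a i) (a j))" if "i \<in> I" for i
      using Ik[OF that] l nonneg by (intro member_le_sum) (auto intro!: cube_defect_nonneg)
    then have "(\<Sum>i\<in>I. cube_defect (a i) (a l))
        \<le> (\<Sum>i\<in>I. \<Sum>j\<in>{..<k} - {i}. cube_defect (a i) (a j))"
      by (rule sum_mono)
    then show ?thesis
      by (simp add: split_l cube_defect_commute[of _ "a l"] flip: I_def)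
  qed
  ultimately have "star_cubic k a
      \<le> m ^ 3 - m * ((a l)\<^sup>2 + B2) - 2/3 * (3 * (a l)\<^sup>2 * t - 3 * a l * B2 + 2 * B3)"
    by (simp add: star_cubic_def Let_def split_l[of "\<lambda>i. (a i)\<^sup>2"] flip: m_def B2_def)
  also have "\<dots> = m ^ 3 - m * (a l)\<^sup>2 - 2 * (a l)\<^sup>2 * t + c * B2 - 4/3 * B3"
    by (simp add: m c algebra_simps)
  also have "\<dots> \<le> m ^ 3 - m * (a l)\<^sup>2 - 2 * (a l)\<^sup>2 * t + c * t\<^sup>2 - 4/3 * B3"
    using \<open>B2 \<le> t\<^sup>2\<close> c by (simp add: mult_left_mono)
  finally have "star_cubic k a + (c ^ 3 / 3 + 2 * (m - a l) * c\<^sup>2) \<le> m ^ 3 / 3 + 4/3 * (t ^ 3 - B3)"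
    by (simp add: m c(1) power2_eq_square power3_eq_cube field_simps)
  also have "\<dots> \<le> balanced_value k * m ^ 3"
  proof (cases "k = 2")
    case True
    then obtain j where "I = {j}"
      using l unfolding I_def by (auto simp: lessThan_Suc numeral_2_eq_2 less_Suc_eq insert_Diff_if)
    then have "t ^ 3 = B3" by (simp add: t_def B3_def)
    with True show ?thesis by (simp add: balanced_value_def power2_eq_square)
  next
    case False
    then have k3: "3 \<le> real k" using k by simp
    have "(2 * t) ^ 3 \<le> m ^ 3"
      using t c by (intro power_mono) (auto simp: m)
    then have "8 * t ^ 3 \<le> m ^ 3"
      by (simp add: power_mult_distrib)
    then have "m ^ 3 / 3 + 4/3 * (t ^ 3 - B3) \<le> 1/2 * m ^ 3"
      using B3 by (simp add: field_simps)
    also have "1/2 \<le> balanced_value k"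
    proof -
      have "0 \<le> (real k - 3) * (3 * real k - 1) + 1"
        using k3 by (intro add_nonneg_nonneg mult_nonneg_nonneg) auto
      then show ?thesis
        using k3 by (simp add: balanced_value_def field_simps power2_eq_square)
    qed
    then have "1/2 * m ^ 3 \<le> balanced_value k * m ^ 3"
      using t by (intro mult_right_mono) auto
    finally show ?thesis .
  qed
  finally show ?thesis .
qed

text \<open>
  At most one leg is longer than half of the total, so at most one excess is positive.
\<close>

lemma star_cubic_excess_le_balanced:
  assumes k: "2 \<le> k" and nonneg: "\<And>i. i < k \<Longrightarrow> 0 \<le> a i" and pos: "0 < (\<Sum>i<k. a i)"
  defines "m \<equiv> \<Sum>i<k. a i"
  shows "star_cubic k a + (\<Sum>i<k. (leg_excess k a i) ^ 3 / 3 + 2 * (m - a i) * (leg_excess k a i)\<^sup>2)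
    \<le> balanced_value k * m ^ 3"
proof (cases "\<exists>l<k. m < 2 * a l")
  case False
  then have "leg_excess k a i = 0" if "i < k" for i
    using that by (force simp: leg_excess_def m_def)
  with star_cubic_le_balanced[OF k nonneg pos] show ?thesis
    by (simp add: m_def)
next
  case True
  then obtain l where l: "l < k" "m < 2 * a l" by blast
  have "leg_excess k a i = 0" if "i < k" "i \<noteq> l" for i
  proof -
    have "a l + a i = (\<Sum>j\<in>{l, i}. a j)" using that by simp
    also have "\<dots> \<le> m"
      unfolding m_def using that l nonneg by (intro sum_mono2) auto
    finally show ?thesis using l by (simp add: leg_excess_def flip: m_def)
  qed
  then have "(\<Sum>i<k. (leg_excess k a i) ^ 3 / 3 + 2 * (m - a i) * (leg_excess k a i)\<^sup>2)
      = (leg_excess k a l) ^ 3 / 3 + 2 * (m - a l) * (leg_excess k a l)\<^sup>2"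
    using l by (subst sum.remove[of _ l]) auto
  moreover have "leg_excess k a l = 2 * a l - m"
    using l by (simp add: leg_excess_def flip: m_def)
  ultimately show ?thesis
    using star_cubic_long_leg_le_balanced[of k a l] k nonneg l by (simp add: m_def)
qed

text \<open>
  If no leg is longer than \<open>s + 1\<close>, where \<open>s = m/k\<close>, then \<open>\<Sum>\<^sub>i a\<^sub>i\<^sup>2 \<le> (s + 1) m\<close> and every
  \<open>cube_defect\<close> is at most \<open>2 (s + 1)\<^sup>3\<close>.  Because \<open>s \<ge> 1\<close>, replacing \<open>s + 1\<close> by \<open>s\<close> costs only
  \<open>O(m\<^sup>2)\<close>.
\<close>

lemma balanced_le_star_cubic:
  assumes k: "2 \<le> k" and "real k \<le> m" and m: "(\<Sum>i<k. a i) = m"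
    and nonneg: "\<And>i. i < k \<Longrightarrow> 0 \<le> a i" and le: "\<And>i. i < k \<Longrightarrow> a i \<le> m / real k + 1"
  shows "balanced_value k * m ^ 3 - 6 * m\<^sup>2 \<le> star_cubic k a"
proof -
  define s where "s = m / real k"
  have k0: "real k \<ge> 2" using k by simp
  have s: "1 \<le> s" and mks: "m = real k * s"
    using \<open>real k \<le> m\<close> k0 by (simp_all add: s_def field_simps)
  have "(\<Sum>i<k. (a i)\<^sup>2) \<le> (\<Sum>i<k. (s + 1) * a i)"
    unfolding power2_eq_square using nonneg le by (intro sum_mono mult_right_mono) (auto simp: s_def)
  also have "\<dots> = (s + 1) * m" by (simp add: m flip: sum_distrib_left)
  finally have Q: "m * (\<Sum>i<k. (a i)\<^sup>2) \<le> m * ((s + 1) * m)"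
    using s k0 by (intro mult_left_mono) (auto simp: mks)
  have "(\<Sum>i<k. \<Sum>j\<in>{..<k} - {i}. cube_defect (a i) (a j))
      \<le> (\<Sum>i<k. \<Sum>j\<in>{..<k} - {i}. 2 * (s + 1) ^ 3)"
    using nonneg le by (intro sum_mono cube_defect_upper) (auto simp: s_def)
  also have "\<dots> = 2 * (real k * (real k - 1)) * (s + 1) ^ 3"
    using k by (simp add: of_nat_diff)
  also have "(s + 1) ^ 3 \<le> s ^ 3 + 7 * s\<^sup>2"
  proof -
    have "s \<le> s\<^sup>2" "1 \<le> s\<^sup>2" using s by (simp_all add: power2_eq_square mult_ge1_I)
    then show ?thesis by (simp add: power2_eq_square power3_eq_cube algebra_simps)
  qed
  then have "2 * (real k * (real k - 1)) * (s + 1) ^ 3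
      \<le> 2 * (real k * (real k - 1)) * (s ^ 3 + 7 * s\<^sup>2)"
    using k0 by (intro mult_left_mono) auto
  finally have "star_cubic k a \<ge> m ^ 3 - m * ((s + 1) * m)
      - 2 * (real k * (real k - 1)) * (s ^ 3 + 7 * s\<^sup>2) / 3"
    unfolding star_cubic_def Let_def m using Q by linarith
  moreover have "m ^ 3 - m * ((s + 1) * m) - 2 * (real k * (real k - 1)) * (s ^ 3 + 7 * s\<^sup>2) / 3
      = s ^ 3 * real k * (real k - 1) * (real k - 2/3) - m\<^sup>2 - 14/3 * (real k * (real k - 1) * s\<^sup>2)"
    by (simp add: mks power2_eq_square power3_eq_cube field_simps)
  moreover have "s ^ 3 * real k * (real k - 1) * (real k - 2/3) = balanced_value k * m ^ 3"
    using k0 by (simp add: balanced_value_def mks field_simps power2_eq_square power3_eq_cube)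
  moreover have "14/3 * (real k * (real k - 1) * s\<^sup>2) \<le> 5 * m\<^sup>2"
  proof -
    have "real k * (real k - 1) * s\<^sup>2 \<le> real k * real k * s\<^sup>2"
      using k0 by (intro mult_right_mono mult_left_mono) auto
    also have "\<dots> = m\<^sup>2" by (simp add: mks power2_eq_square)
    finally have "real k * (real k - 1) * s\<^sup>2 \<le> m\<^sup>2" .
    moreover have "0 \<le> m\<^sup>2" by simp
    ultimately show ?thesis by linarith
  qed
  ultimately show ?thesis by linarith
qed

section \<open>Sums over a pair of legs\<close>

text \<open>
  The truncated sums are half of what the absolute values add.  Each is
  estimated by telescoping: the summand is dominated by the decrease of the next higher power of
  the truncation.
\<close>

lemma sum_truncated_le_square:
  "2 * (\<Sum>x=1..n::nat. max 0 (c - real x)) \<le> (max 0 c)\<^sup>2"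
proof -
  have "2 * (\<Sum>x=1..n. max 0 (c - real x)) + (max 0 (c - real n))\<^sup>2 \<le> (max 0 c)\<^sup>2"
  proof (induction n)
    case (Suc n)
    have "2 * max 0 (c - real (Suc n)) + (max 0 (c - real (Suc n)))\<^sup>2 \<le> (max 0 (c - real n))\<^sup>2"
    proof (cases "c \<le> real (Suc n)")
      case False
      define e where "e = c - real (Suc n)"
      have "c - real n = e + 1" "0 < e" using False by (simp_all add: e_def)
      then show ?thesis
        by (simp add: max_def power2_eq_square algebra_simps flip: e_def)
    qed simp
    with Suc show ?case by simp
  qed simp
  then show ?thesis
    using zero_le_power2[of "max 0 (c - real n)"] by linarith
qed

lemma sum_truncated_square_le_cube:
  "3 * (\<Sum>x=1..n::nat. (max 0 (c - real x))\<^sup>2) \<le> (max 0 c) ^ 3"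
proof -
  have "3 * (\<Sum>x=1..n. (max 0 (c - real x))\<^sup>2) + (max 0 (c - real n)) ^ 3 \<le> (max 0 c) ^ 3"
  proof (induction n)
    case (Suc n)
    have "3 * (max 0 (c - real (Suc n)))\<^sup>2 + (max 0 (c - real (Suc n))) ^ 3
        \<le> (max 0 (c - real n)) ^ 3"
    proof (cases "c \<le> real (Suc n)")
      case False
      define e where "e = c - real (Suc n)"
      have "c - real n = e + 1" "0 < e" using False by (simp_all add: e_def)
      then show ?thesis
        by (simp add: max_def power2_eq_square power3_eq_cube algebra_simps flip: e_def)
    qed simp
    with Suc show ?case by simp
  qed simp
  moreover have "0 \<le> (max 0 (c - real n)) ^ 3" by simp
  ultimately show ?thesis by linarith
qed

lemma sum_truncated_le_cube:
  "6 * (\<Sum>x=1..n::nat. \<Sum>y=1..l::nat. max 0 (c - (real x + real y))) \<le> (max 0 c) ^ 3"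
proof -
  have "2 * (\<Sum>y=1..l. max 0 (c - (real x + real y))) \<le> (max 0 (c - real x))\<^sup>2" for x
    using sum_truncated_le_square[of "c - real x" l] by (simp add: diff_diff_eq)
  then have "(\<Sum>x=1..n. 2 * (\<Sum>y=1..l. max 0 (c - (real x + real y))))
      \<le> (\<Sum>x=1..n. (max 0 (c - real x))\<^sup>2)"
    by (rule sum_mono)
  then show ?thesis
    using sum_truncated_square_le_cube[of c n] by (simp flip: sum_distrib_left)
qed

text \<open>
  Only the difference \<open>x - y\<close> matters, so this is the sum in \<open>sum_truncated_le_square\<close>, started beyond \<open>y\<close>.
\<close>

lemma sum_truncated_shift_le_square:
  "2 * (\<Sum>x=1..n::nat. if y < x then max 0 (c - (real x - real y)) else 0) \<le> (max 0 c)\<^sup>2"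
proof -
  have "(\<Sum>x=1..n. if y < x then max 0 (c - (real x - real y)) else 0)
      = (\<Sum>z=1..n - y. max 0 (c - real z))"
  proof (induction n)
    case (Suc n)
    then show ?case
      by (cases "y < Suc n") (auto simp: Suc_diff_le of_nat_diff algebra_simps)
  qed simp
  then show ?thesis using sum_truncated_le_square by simp
qed

lemma sum_quadratic:
  "(\<Sum>y=1..n::nat. p + q * real y + (real y)\<^sup>2)
    = p * real n + q * (real n * (real n + 1) / 2) + real n * (real n + 1) * (2 * real n + 1) / 6"
  by (induction n) (simp_all add: field_simps power2_eq_square)

text \<open>
  This is the shape of a row of \<open>cross_value\<close>: for a fixed vertex on the second leg, the vertices
  of the first leg closer to the center and those farther from it give two arithmetic
  progressions.
\<close>

lemma sum_two_slopes:
  "(\<Sum>x=1..z + e. if x \<le> z then p - real x else q + real x)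
    = p * real z - real z * (real z + 1) / 2 + q * real e + real e * (2 * real z + real e + 1) / 2"
proof (induction e)
  case 0
  have "(\<Sum>x=1..z. p - real x) = p * real z - real z * (real z + 1) / 2"
    by (induction z) (simp_all add: field_simps)
  moreover have "(\<Sum>x=1..z. if x \<le> z then p - real x else q + real x) = (\<Sum>x=1..z. p - real x)"
    by (intro sum.cong) auto
  ultimately show ?case by simp
next
  case (Suc e)
  then show ?case by (simp add: field_simps)
qed

text \<open>
  The signed imbalance of the vertices at positions \<open>x\<close> and \<open>y\<close> of two legs of lengths \<open>a\<close> and
  \<open>b\<close>.  For \<open>x = y\<close> neither vertex is farther; the value chosen there keeps the function symmetric
  and, if \<open>b \<le> a\<close>, extends the formula for \<open>y < x\<close>.
\<close>

definition cross_value :: "real \<Rightarrow> nat \<Rightarrow> nat \<Rightarrow> nat \<Rightarrow> nat \<Rightarrow> real" where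
  "cross_value m a b x y =
     m - 2 * real (if x < y then b else if y < x then a else max a b) + \<bar>real x - real y\<bar>"

lemma cross_value_commute: "cross_value m a b x y = cross_value m b a y x"
  by (auto simp: cross_value_def)

text \<open>
  In row \<open>y\<close> the formula changes at \<open>x = y\<close>; since \<open>b \<le> a\<close>, every row reaches this point, and the
  row sums are a single quadratic polynomial in \<open>y\<close>.
\<close>

lemma sum_cross_value:
  assumes "b \<le> a"
  shows "(\<Sum>x=1..a. \<Sum>y=1..b. cross_value m a b x y)
    = m * real a * real b - real a * real b * (real a + real b) / 2 - cube_defect a b / 3
      + ((real b)\<^sup>2 - real a * real b - real b / 3)"
proof -
  have inner: "(\<Sum>x=1..a. cross_value m a b x y)
      = (m * real a - 3/2 * (real a)\<^sup>2 - 3/2 * real a + 2 * real b) + (real a - 2 * real b - 1) * y + (real y)\<^sup>2"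
    if "1 \<le> y" "y \<le> b" for y
  proof -
    define e where "e = a - (y - 1)"
    have a: "a = (y - 1) + e" using that assms by (simp add: e_def)
    have "(\<Sum>x=1..a. cross_value m a b x y)
      = (\<Sum>x=1..(y - 1) + e. if x \<le> y - 1 then (m - 2 * b + y) - real x
            else (m - 2 * a - y) + real x)"
      using that assms by (intro sum.cong) (auto simp: cross_value_def a)
    also have "\<dots> = (m - 2 * b + y) * real (y - 1) - real (y - 1) * (real (y - 1) + 1) / 2
        + (m - 2 * a - y) * e + real e * (2 * real (y - 1) + real e + 1) / 2"
      by (rule sum_two_slopes)
    also have "real (y - 1) = real y - 1" using that by simp
    also have "real e = real a - real y + 1"
      using that assms by (simp add: e_def of_nat_diff)
    finally show ?thesis by (simp add: field_simps power2_eq_square)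
  qed
  have "(\<Sum>x=1..a. \<Sum>y=1..b. cross_value m a b x y) = (\<Sum>y=1..b. \<Sum>x=1..a. cross_value m a b x y)"
    by (rule sum.swap)
  also have "\<dots> = (\<Sum>y=1..b. (m * real a - 3/2 * (real a)\<^sup>2 - 3/2 * real a + 2 * real b)
      + (real a - 2 * real b - 1) * y + (real y)\<^sup>2)"
    using inner by (intro sum.cong) auto
  also have "\<dots> = (m * real a - 3/2 * (real a)\<^sup>2 - 3/2 * real a + 2 * real b) * b
      + (real a - 2 * real b - 1) * (real b * (real b + 1) / 2)
      + real b * (real b + 1) * (2 * real b + 1) / 6"
    by (rule sum_quadratic)
  finally show ?thesis
    using assms by (simp add: cube_defect_le field_simps power2_eq_square power3_eq_cube)
qed

text \<open>
  The lower-order term of \<open>sum_cross_value\<close> lies between \<open>- 2 a b\<close> and \<open>0\<close>.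
\<close>

lemma sum_cross_value_bounds:
  defines "T \<equiv> \<lambda>m a b. m * real a * real b - real a * real b * (real a + real b) / 2 - cube_defect a b / 3"
  shows "(\<Sum>x=1..a. \<Sum>y=1..b. cross_value m a b x y) \<le> T m a b"
    and "T m a b - 2 * real a * real b \<le> (\<Sum>x=1..a. \<Sum>y=1..b. cross_value m a b x y)"
proof -
  have "(\<Sum>x=1..a. \<Sum>y=1..b. cross_value m a b x y) \<le> T m a b \<and>
     T m a b - 2 * real a * real b \<le> (\<Sum>x=1..a. \<Sum>y=1..b. cross_value m a b x y)"
  proof (induction a b rule: linorder_wlog)
    case (sym a b)
    have "(\<Sum>x=1..b. \<Sum>y=1..a. cross_value m b a x y) = (\<Sum>x=1..a. \<Sum>y=1..b. cross_value m a b x y)"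
      by (subst sum.swap) (simp add: cross_value_commute[of m b a])
    with sym show ?case
      by (simp add: T_def cube_defect_commute[of "real b"] mult.commute mult.left_commute add.commute)
  next
    case (le b a)
    have "real b * real b \<le> real a * real b" "real b \<le> real a * real b"
      using le by (auto simp: mult_right_mono simp flip: of_nat_mult)
    moreover have "0 \<le> real b * real b" by simp
    ultimately have "real b * real b - real a * real b - real b / 3 \<le> 0"
      "- 2 * (real a * real b) \<le> real b * real b - real a * real b - real b / 3"
      by linarith+
    moreover have "(\<Sum>x=1..b. \<Sum>y=1..a. cross_value m b a x y) = (\<Sum>x=1..a. \<Sum>y=1..b. cross_value m a b x y)"
      by (subst sum.swap) (simp add: cross_value_commute[of m b a])
    ultimately show ?case
      using sum_cross_value[OF le, of m]
      by (simp add: T_def power2_eq_square cube_defect_commute[of "real b"] algebra_simps)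
  qed
  then show "(\<Sum>x=1..a. \<Sum>y=1..b. cross_value m a b x y) \<le> T m a b"
    and "T m a b - 2 * real a * real b \<le> (\<Sum>x=1..a. \<Sum>y=1..b. cross_value m a b x y)" by auto
qed

lemma sum_same_leg:
  "(\<Sum>x=1..a::nat. \<Sum>y=1..a::nat. (m - 2 * real a) + (real x + real y))
    = (real a)\<^sup>2 * (m - a) + (real a)\<^sup>2"
proof -
  have gauss: "(\<Sum>x=1..a. real x) = real a * (real a + 1) / 2"
    by (induction a) (simp_all add: field_simps)
  have "(\<Sum>x=1..a. \<Sum>y=1..a. (m - 2 * real a) + (real x + real y))
      = (\<Sum>x=1..a. real a * (m - 2 * real a) + (real a * real x + (\<Sum>y=1..a. real y)))"
    by (simp add: sum.distrib)
  also have "\<dots> = real a * (real a * (m - 2 * real a))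
      + (real a * (\<Sum>x=1..a. real x) + real a * (\<Sum>y=1..a. real y))"
    by (simp add: sum.distrib flip: sum_distrib_left)
  finally show ?thesis
    unfolding gauss by (simp add: field_simps power2_eq_square)
qed

section \<open>Distance-unbalancedness as a sum over pairs of legs\<close>

abbreviation star_imbalance :: "nat list \<Rightarrow> nat \<times> nat \<Rightarrow> nat \<times> nat \<Rightarrow> real" where
  "star_imbalance ns u v \<equiv> real_of_int (imbalance (subdivided_star ns) u v)"

lemma star_imbalance_legs:
  assumes "i < length ns" "1 \<le> x" "x \<le> ns ! i" "j < length ns" "1 \<le> y" "y \<le> ns ! j" "x \<noteq> y"
  shows "star_imbalance ns (i, x) (j, y)
    = \<bar>if i = j then (real (sum_list ns) - 2 * real (ns ! i)) + (real x + real y)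
       else cross_value (real (sum_list ns)) (ns ! i) (ns ! j) x y\<bar>"
proof (cases "x < y")
  case True
  have "star_imbalance ns (i, x) (j, y) = real_of_int
     \<bar>int (sum_list ns) - 2 * int (ns ! j) + (if i = j then int x + int y else int y - int x)\<bar>"
    using assms True by (subst imbalance_legs) auto
  also have "\<dots> = \<bar>real (sum_list ns) - 2 * real (ns ! j)
      + (if i = j then real x + real y else real y - real x)\<bar>"
    by simp
  finally show ?thesis
    using True by (simp add: cross_value_def)
next
  case False
  then have "y < x" using assms by simp
  have "star_imbalance ns (i, x) (j, y) = real_of_int
     \<bar>int (sum_list ns) - 2 * int (ns ! i) + (if j = i then int y + int x else int x - int y)\<bar>"
    using assms \<open>y < x\<close> by (subst imbalance_commute, subst imbalance_legs) auto
  also have "\<dots> = \<bar>real (sum_list ns) - 2 * real (ns ! i)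
      + (if j = i then real y + real x else real x - real y)\<bar>"
    by simp
  finally show ?thesis
    using \<open>y < x\<close> by (simp add: cross_value_def add.commute)
qed

lemma star_imbalance_nonneg: "0 \<le> star_imbalance ns u v"
  by (simp add: imbalance_nonneg)

lemma star_imbalance_le: "star_imbalance ns u v \<le> real (sum_list ns) + 1"
proof -
  have "finite (pverts (subdivided_star ns))"
    by (simp add: pverts_subdivided_star)
  from imbalance_le_card[OF this, of u v]
  have "imbalance (subdivided_star ns) u v \<le> int (1 + sum_list ns)"
    by (simp add: card_pverts_subdivided_star)
  then have "star_imbalance ns u v \<le> real_of_int (int (1 + sum_list ns))"
    by (rule of_int_le_iff[THEN iffD2])
  then show ?thesis by simp
qed

definition leg_pair_sum :: "nat list \<Rightarrow> nat \<Rightarrow> nat \<Rightarrow> real" where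
  "leg_pair_sum ns i j = (\<Sum>x=1..ns ! i. \<Sum>y=1..ns ! j. star_imbalance ns (i, x) (j, y))"

text \<open>
  The difference is made up of the pairs with the center: at most \<open>2 m\<close> ordered pairs, each of
  imbalance at most \<open>m + 1\<close>.
\<close>

lemma two_uB_leg_pair_sums:
  fixes ns :: "nat list"
  defines "m \<equiv> real (sum_list ns)" and "k \<equiv> length ns"
  shows "(\<Sum>i<k. \<Sum>j<k. leg_pair_sum ns i j) \<le> 2 * real_of_int (uB (subdivided_star ns))"
    and "2 * real_of_int (uB (subdivided_star ns))
      \<le> (\<Sum>i<k. \<Sum>j<k. leg_pair_sum ns i j) + 2 * (m * (m + 1))"
proof -
  define W where "W = (SIGMA i:{..<k}. {1..ns ! i})"
  define D where "D = star_imbalance ns"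
  have V: "pverts (subdivided_star ns) = insert (0, 0) W"
    by (simp add: W_def k_def pverts_subdivided_star)
  have finW: "finite W" and cW: "(0, 0) \<notin> W"
    by (auto simp: W_def)
  have "card W = sum_list ns"
    using card_pverts_subdivided_star[of ns] finW cW by (simp add: V)
  have W_sum: "(\<Sum>u\<in>W. f u) = (\<Sum>i<k. \<Sum>x=1..ns ! i. f (i, x))" for f :: "nat \<times> nat \<Rightarrow> real"
    unfolding W_def by (subst sum.Sigma) auto
  have "2 * real_of_int (uB (subdivided_star ns)) = real_of_int (2 * uB (subdivided_star ns))"
    by simp
  also have "\<dots> = (\<Sum>u\<in>insert (0, 0) W. \<Sum>v\<in>insert (0, 0) W. D u v)"
    using finW by (subst two_uB_eq_ordered_sum) (simp_all add: V D_def)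
  also have "\<dots> = D (0, 0) (0, 0) + (\<Sum>v\<in>W. D (0, 0) v) + ((\<Sum>u\<in>W. D u (0, 0)) + (\<Sum>u\<in>W. \<Sum>v\<in>W. D u v))"
    using finW cW by (simp add: sum.distrib)
  also have "D (0, 0) (0, 0) = 0" by (simp add: D_def imbalance_self)
  also have "(\<Sum>u\<in>W. D u (0, 0)) = (\<Sum>v\<in>W. D (0, 0) v)"
    by (simp add: D_def imbalance_commute[of _ _ "(0, 0)"])
  also have "(\<Sum>u\<in>W. \<Sum>v\<in>W. D u v) = (\<Sum>i<k. \<Sum>j<k. leg_pair_sum ns i j)"
  proof -
    have "(\<Sum>u\<in>W. \<Sum>v\<in>W. D u v)
        = (\<Sum>i<k. \<Sum>x=1..ns ! i. \<Sum>j<k. \<Sum>y=1..ns ! j. D (i, x) (j, y))"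
      by (simp add: W_sum)
    also have "\<dots> = (\<Sum>i<k. \<Sum>j<k. \<Sum>x=1..ns ! i. \<Sum>y=1..ns ! j. D (i, x) (j, y))"
      by (intro sum.cong refl sum.swap)
    finally show ?thesis by (simp add: leg_pair_sum_def D_def)
  qed
  finally have total: "2 * real_of_int (uB (subdivided_star ns))
      = 2 * (\<Sum>v\<in>W. D (0, 0) v) + (\<Sum>i<k. \<Sum>j<k. leg_pair_sum ns i j)"
    by simp
  have "(\<Sum>v\<in>W. D (0, 0) v) \<le> (\<Sum>v\<in>W. m + 1)"
    unfolding D_def m_def by (intro sum_mono star_imbalance_le)
  also have "\<dots> = m * (m + 1)"
    by (simp add: \<open>card W = sum_list ns\<close> m_def)
  finally have "(\<Sum>v\<in>W. D (0, 0) v) \<le> m * (m + 1)" .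
  with total show "2 * real_of_int (uB (subdivided_star ns))
      \<le> (\<Sum>i<k. \<Sum>j<k. leg_pair_sum ns i j) + 2 * (m * (m + 1))"
    by simp
  have "0 \<le> (\<Sum>v\<in>W. D (0, 0) v)"
    unfolding D_def by (intro sum_nonneg star_imbalance_nonneg)
  with total show "(\<Sum>i<k. \<Sum>j<k. leg_pair_sum ns i j) \<le> 2 * real_of_int (uB (subdivided_star ns))"
    by simp
qed

lemma sum_diagonal_le:
  assumes "0 \<le> d"
  shows "(\<Sum>x=1..a::nat. \<Sum>y=1..b::nat. if x = y then d else 0) \<le> real a * (d::real)"
proof -
  have "(\<Sum>x=1..a. \<Sum>y=1..b. if x = y then d else 0) \<le> (\<Sum>x=1..a. d)"
    using assms by (intro sum_mono) (simp add: sum.delta')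
  then show ?thesis by simp
qed

text \<open>
  Undoing an absolute value costs twice the negative part.
\<close>

lemma abs_le_add_truncated:
  fixes t :: real
  assumes "- t \<le> r"
  shows "\<bar>t\<bar> \<le> t + 2 * max 0 r"
  using assms by (auto simp: abs_if max_def)

text \<open>
  The upper bound keeps the negative parts as a truncated sum.  The lower bound only has to account
  for the diagonal \<open>x = y\<close>, where the imbalance is zero and the linear expression is at most \<open>m\<close>.
\<close>

lemma leg_pair_sum_same_bounds:
  fixes ns :: "nat list"
  assumes i: "i < length ns"
  defines "m \<equiv> real (sum_list ns)" and "a \<equiv> real (ns ! i)"
  shows "leg_pair_sum ns i i \<le> a\<^sup>2 * (m - a) + a\<^sup>2 + (max 0 (2 * a - m)) ^ 3 / 3"
    and "a\<^sup>2 * (m - a) - m * a \<le> leg_pair_sum ns i i"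
proof -
  let ?t = "\<lambda>x y. (m - 2 * a) + (real x + real y)"
  have D: "star_imbalance ns (i, x) (i, y) = (if x = y then 0 else \<bar>?t x y\<bar>)"
    if "x \<in> {1..ns ! i}" "y \<in> {1..ns ! i}" for x y
    using that i star_imbalance_legs[of i ns x i y] by (simp add: imbalance_self m_def a_def)
  have "leg_pair_sum ns i i
      \<le> (\<Sum>x=1..ns ! i. \<Sum>y=1..ns ! i. ?t x y + 2 * max 0 ((2 * a - m) - (real x + real y)))"
    unfolding leg_pair_sum_def
  proof (intro sum_mono)
    fix x y assume "x \<in> {1..ns ! i}" "y \<in> {1..ns ! i}"
    then have "star_imbalance ns (i, x) (i, y) \<le> \<bar>?t x y\<bar>"
      by (simp add: D)
    also have "\<dots> \<le> ?t x y + 2 * max 0 ((2 * a - m) - (real x + real y))"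
      by (rule abs_le_add_truncated) simp
    finally show "star_imbalance ns (i, x) (i, y)
        \<le> ?t x y + 2 * max 0 ((2 * a - m) - (real x + real y))" .
  qed
  also have "\<dots> = (\<Sum>x=1..ns ! i. \<Sum>y=1..ns ! i. ?t x y)
      + 2 * (\<Sum>x=1..ns ! i. \<Sum>y=1..ns ! i. max 0 ((2 * a - m) - (real x + real y)))"
    by (simp only: sum.distrib sum_distrib_left)
  also have "(\<Sum>x=1..ns ! i. \<Sum>y=1..ns ! i. ?t x y) = a\<^sup>2 * (m - a) + a\<^sup>2"
    unfolding a_def by (rule sum_same_leg)
  finally show "leg_pair_sum ns i i \<le> a\<^sup>2 * (m - a) + a\<^sup>2 + (max 0 (2 * a - m)) ^ 3 / 3"
    using sum_truncated_le_cube[of "2 * a - m" "ns ! i" "ns ! i"] by linarith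
  have "(\<Sum>x=1..ns ! i. \<Sum>y=1..ns ! i. ?t x y - (if x = y then m else 0)) \<le> leg_pair_sum ns i i"
    unfolding leg_pair_sum_def by (intro sum_mono) (auto simp: D a_def)
  moreover have "(\<Sum>x=1..ns ! i. \<Sum>y=1..ns ! i. ?t x y - (if x = y then m else 0))
      = (\<Sum>x=1..ns ! i. \<Sum>y=1..ns ! i. ?t x y)
        - (\<Sum>x=1..ns ! i. \<Sum>y=1..ns ! i. if x = y then m else 0)"
    by (simp only: sum_subtractf)
  moreover have "(\<Sum>x=1..ns ! i. \<Sum>y=1..ns ! i. ?t x y) = a\<^sup>2 * (m - a) + a\<^sup>2"
    unfolding a_def by (rule sum_same_leg)
  moreover have "(\<Sum>x=1..ns ! i. \<Sum>y=1..ns ! i. if x = y then m else 0) \<le> a * m"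
    unfolding a_def by (rule sum_diagonal_le) (simp add: m_def)
  moreover have "0 \<le> a\<^sup>2" "a * m = m * a" by simp_all
  ultimately show "a\<^sup>2 * (m - a) - m * a \<le> leg_pair_sum ns i i"
    by linarith
qed

text \<open>
  A pair with \<open>y < x\<close> can have a negative sign only through an excess of leg \<open>i\<close>, one with
  \<open>x < y\<close> only through an excess of leg \<open>j\<close>.  On the diagonal \<open>x = y\<close>, where the formula for the
  imbalance does not apply, the error is at most \<open>3 m\<close> in the upper bound and \<open>m\<close> in the lower
  bound.  Summed over all pairs of legs, these diagonals cause the error term \<open>O(k m\<^sup>2)\<close>.
\<close>

lemma leg_pair_sum_cross_bounds:
  fixes ns :: "nat list"
  assumes i: "i < length ns" and j: "j < length ns" and "i \<noteq> j"
  defines "m \<equiv> real (sum_list ns)" and "a \<equiv> real (ns ! i)" and "b \<equiv> real (ns ! j)"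
  defines "T \<equiv> m * a * b - a * b * (a + b) / 2 - cube_defect a b / 3"
  shows "leg_pair_sum ns i j
      \<le> T + b * (max 0 (2 * a - m))\<^sup>2 + a * (max 0 (2 * b - m))\<^sup>2 + 3 * m * a"
    and "T - 2 * a * b - m * a \<le> leg_pair_sum ns i j"
proof -
  let ?X = "{1..ns ! i}" and ?Y = "{1..ns ! j}"
  let ?t = "cross_value m (ns ! i) (ns ! j)"
  let ?p = "\<lambda>x y. if y < x then max 0 ((2 * a - m) - (real x - real y)) else 0"
  let ?q = "\<lambda>x y. if x < y then max 0 ((2 * b - m) - (real y - real x)) else 0"
  let ?d = "\<lambda>d x y. if x = y then d else (0::real)"
  have D: "star_imbalance ns (i, x) (j, y) = \<bar>?t x y\<bar>"
    if "x \<in> ?X" "y \<in> ?Y" "x \<noteq> y" for x y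
    using that i j \<open>i \<noteq> j\<close> star_imbalance_legs[of i ns x j y] by (simp add: m_def)
  have am: "a \<le> m" "b \<le> m"
    using i j by (auto simp: a_def b_def m_def intro!: member_le_sum_list)
  have m1: "1 \<le> m" if "x \<in> ?X" for x
  proof -
    have "1 \<le> a" using that by (auto simp: a_def)
    with am show ?thesis by simp
  qed
  have Tsum: "(\<Sum>x\<in>?X. \<Sum>y\<in>?Y. ?t x y) \<le> T" "T - 2 * a * b \<le> (\<Sum>x\<in>?X. \<Sum>y\<in>?Y. ?t x y)"
    unfolding T_def a_def b_def by (rule sum_cross_value_bounds)+
  have "leg_pair_sum ns i j
      \<le> (\<Sum>x\<in>?X. \<Sum>y\<in>?Y. ?t x y + 2 * ?p x y + 2 * ?q x y + ?d (3 * m) x y)"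
    unfolding leg_pair_sum_def
  proof (intro sum_mono)
    fix x y assume xy: "x \<in> ?X" "y \<in> ?Y"
    consider "x < y" | "y < x" | "x = y" by linarith
    then show "star_imbalance ns (i, x) (j, y)
        \<le> ?t x y + 2 * ?p x y + 2 * ?q x y + ?d (3 * m) x y"
    proof cases
      case 1
      then have "\<bar>?t x y\<bar> \<le> ?t x y + 2 * max 0 ((2 * b - m) - (real y - real x))"
        by (intro abs_le_add_truncated) (simp add: cross_value_def b_def)
      with 1 xy show ?thesis by (simp add: D)
    next
      case 2
      then have "\<bar>?t x y\<bar> \<le> ?t x y + 2 * max 0 ((2 * a - m) - (real x - real y))"
        by (intro abs_le_add_truncated) (simp add: cross_value_def a_def)
      with 2 xy show ?thesis by (simp add: D)
    next
      case 3
      have "- m \<le> ?t x y"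
        using 3 am by (simp add: cross_value_def a_def b_def)
      with 3 m1[OF xy(1)] star_imbalance_le[of ns "(i, x)" "(j, y)"] show ?thesis
        by (simp add: m_def)
    qed
  qed
  also have "\<dots> = (\<Sum>x\<in>?X. \<Sum>y\<in>?Y. ?t x y) + 2 * (\<Sum>x\<in>?X. \<Sum>y\<in>?Y. ?p x y)
      + 2 * (\<Sum>x\<in>?X. \<Sum>y\<in>?Y. ?q x y) + (\<Sum>x\<in>?X. \<Sum>y\<in>?Y. ?d (3 * m) x y)"
    by (simp only: sum.distrib sum_distrib_left)
  also have "(\<Sum>x\<in>?X. \<Sum>y\<in>?Y. ?p x y) = (\<Sum>y\<in>?Y. \<Sum>x\<in>?X. ?p x y)"
    by (rule sum.swap)
  finally have "leg_pair_sum ns i j \<le> (\<Sum>x\<in>?X. \<Sum>y\<in>?Y. ?t x y) + 2 * (\<Sum>y\<in>?Y. \<Sum>x\<in>?X. ?p x y)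
      + 2 * (\<Sum>x\<in>?X. \<Sum>y\<in>?Y. ?q x y) + (\<Sum>x\<in>?X. \<Sum>y\<in>?Y. ?d (3 * m) x y)" .
  moreover have "2 * (\<Sum>y\<in>?Y. \<Sum>x\<in>?X. ?p x y) \<le> b * (max 0 (2 * a - m))\<^sup>2"
  proof -
    have "(\<Sum>y\<in>?Y. 2 * (\<Sum>x\<in>?X. ?p x y)) \<le> (\<Sum>y\<in>?Y. (max 0 (2 * a - m))\<^sup>2)"
      by (intro sum_mono sum_truncated_shift_le_square)
    then show ?thesis by (simp add: b_def flip: sum_distrib_left)
  qed
  moreover have "2 * (\<Sum>x\<in>?X. \<Sum>y\<in>?Y. ?q x y) \<le> a * (max 0 (2 * b - m))\<^sup>2"
  proof -
    have "(\<Sum>x\<in>?X. 2 * (\<Sum>y\<in>?Y. ?q x y)) \<le> (\<Sum>x\<in>?X. (max 0 (2 * b - m))\<^sup>2)"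
      by (intro sum_mono sum_truncated_shift_le_square)
    then show ?thesis by (simp add: a_def flip: sum_distrib_left)
  qed
  moreover have "(\<Sum>x\<in>?X. \<Sum>y\<in>?Y. ?d (3 * m) x y) \<le> a * (3 * m)"
    unfolding a_def by (rule sum_diagonal_le) (simp add: m_def)
  ultimately show "leg_pair_sum ns i j
      \<le> T + b * (max 0 (2 * a - m))\<^sup>2 + a * (max 0 (2 * b - m))\<^sup>2 + 3 * m * a"
    using Tsum by (simp add: mult.commute)
  have "(\<Sum>x\<in>?X. \<Sum>y\<in>?Y. ?t x y - ?d m x y) \<le> leg_pair_sum ns i j"
    unfolding leg_pair_sum_def
  proof (intro sum_mono)
    fix x y assume xy: "x \<in> ?X" "y \<in> ?Y"
    show "?t x y - ?d m x y \<le> star_imbalance ns (i, x) (j, y)"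
    proof (cases "x = y")
      case True
      then have "?t x y - ?d m x y \<le> 0" by (simp add: cross_value_def)
      then show ?thesis using star_imbalance_nonneg order_trans by blast
    next
      case False
      with D[OF xy] show ?thesis by simp
    qed
  qed
  moreover have "(\<Sum>x\<in>?X. \<Sum>y\<in>?Y. ?t x y - ?d m x y)
      = (\<Sum>x\<in>?X. \<Sum>y\<in>?Y. ?t x y) - (\<Sum>x\<in>?X. \<Sum>y\<in>?Y. ?d m x y)"
    by (simp only: sum_subtractf)
  moreover have "(\<Sum>x\<in>?X. \<Sum>y\<in>?Y. ?d m x y) \<le> a * m"
    unfolding a_def by (rule sum_diagonal_le) (simp add: m_def)
  ultimately show "T - 2 * a * b - m * a \<le> leg_pair_sum ns i j"
    using Tsum by (simp add: mult.commute)
qed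

section \<open>The maximum over all leg lengths\<close>

lemma sum_off_diagonal:
  fixes f :: "nat \<Rightarrow> nat \<Rightarrow> real"
  shows "(\<Sum>i<k. \<Sum>j\<in>{..<k} - {i}. f i j) = (\<Sum>i<k. \<Sum>j<k. f i j) - (\<Sum>i<k. f i i)"
  by (simp add: sum_diff1 sum_subtractf)

text \<open>
  The terms of second order in the pairs combine to \<open>m (\<Sum>\<^sub>i a\<^sub>i)\<^sup>2 = m\<^sup>3\<close>.  Those of third order
  combine to \<open>m \<Sum>\<^sub>i a\<^sub>i\<^sup>2\<close>, because \<open>a\<^sub>i\<^sup>3\<close> is the missing diagonal term
  \<open>a\<^sub>i a\<^sub>i (a\<^sub>i + a\<^sub>i) / 2\<close>.
\<close>

lemma star_cubic_pairs:
  fixes a :: "nat \<Rightarrow> real" and k :: nat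
  defines "m \<equiv> \<Sum>i<k. a i"
  shows "(\<Sum>i<k. (a i)\<^sup>2 * (m - a i)) + (\<Sum>i<k. \<Sum>j\<in>{..<k} - {i}.
      m * a i * a j - a i * a j * (a i + a j) / 2 - cube_defect (a i) (a j) / 3) = star_cubic k a"
proof -
  define Q where "Q = (\<Sum>i<k. (a i)\<^sup>2)"
  have "(\<Sum>i<k. \<Sum>j<k. m * a i * a j - a i * a j * (a i + a j) / 2)
      = (\<Sum>i<k. m * m * a i - (m * (a i)\<^sup>2 + Q * a i) / 2)"
  proof (rule sum.cong[OF refl])
    fix i
    have "(\<Sum>j<k. m * a i * a j - a i * a j * (a i + a j) / 2)
        = (\<Sum>j<k. (m * a i - (a i)\<^sup>2 / 2) * a j - (a i / 2) * (a j)\<^sup>2)"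
      by (intro sum.cong refl) (simp add: field_simps power2_eq_square)
    also have "\<dots> = (m * a i - (a i)\<^sup>2 / 2) * m - (a i / 2) * Q"
      by (simp only: sum_subtractf sum_distrib_left m_def Q_def)
    finally show "(\<Sum>j<k. m * a i * a j - a i * a j * (a i + a j) / 2)
        = m * m * a i - (m * (a i)\<^sup>2 + Q * a i) / 2"
      by (simp add: field_simps)
  qed
  also have "\<dots> = (\<Sum>i<k. (m * m - Q / 2) * a i - (m / 2) * (a i)\<^sup>2)"
    by (intro sum.cong refl) (simp add: field_simps)
  also have "\<dots> = (m * m - Q / 2) * m - (m / 2) * Q"
    by (simp only: sum_subtractf sum_distrib_left[symmetric] m_def[symmetric] Q_def[symmetric])
  finally have full: "(\<Sum>i<k. \<Sum>j<k. m * a i * a j - a i * a j * (a i + a j) / 2) = m ^ 3 - m * Q"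
    by (simp add: field_simps power3_eq_cube)
  have "(\<Sum>i<k. m * a i * a i - a i * a i * (a i + a i) / 2) = (\<Sum>i<k. (a i)\<^sup>2 * (m - a i))"
    by (intro sum.cong refl) (simp add: field_simps power2_eq_square)
  with full have "(\<Sum>i<k. (a i)\<^sup>2 * (m - a i)) + (\<Sum>i<k. \<Sum>j\<in>{..<k} - {i}.
      m * a i * a j - a i * a j * (a i + a j) / 2) = m ^ 3 - m * Q"
    unfolding sum_off_diagonal by simp
  then show ?thesis
    by (simp add: star_cubic_def Let_def sum_subtractf sum_divide_distrib flip: m_def Q_def)
qed

lemma two_uB_star_cubic_bounds:
  fixes ns :: "nat list"
  assumes k: "2 \<le> length ns"
  defines "k \<equiv> length ns" and "m \<equiv> real (sum_list ns)" and "a \<equiv> \<lambda>i. real (ns ! i)"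
  shows "2 * real_of_int (uB (subdivided_star ns))
    \<le> star_cubic k a + (\<Sum>i<k. (leg_excess k a i) ^ 3 / 3 + 2 * (m - a i) * (leg_excess k a i)\<^sup>2)
      + 6 * real k * m\<^sup>2 + 2 * m"
    and "star_cubic k a - 4 * real k * m\<^sup>2 \<le> 2 * real_of_int (uB (subdivided_star ns))"
proof -
  define c where "c = leg_excess k a"
  define S where "S = (\<lambda>i j. m * a i * a j - a i * a j * (a i + a j) / 2 - cube_defect (a i) (a j) / 3)"
  have m: "(\<Sum>i<k. a i) = m"
    by (simp add: m_def a_def k_def sum_list_sum_nth atLeast0LessThan)
  have c: "c i = max 0 (2 * a i - m)" for i
    by (simp add: c_def leg_excess_def m)
  have a0: "0 \<le> a i" for i by (simp add: a_def)
  have am: "a i \<le> m" if "i < k" for i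
    using that by (auto simp: a_def m_def k_def intro!: member_le_sum_list)
  have k2: "2 \<le> real k" using k by (simp add: k_def)
  have m0: "0 \<le> m" by (simp add: m_def)
  have sq: "(\<Sum>i<k. (a i)\<^sup>2) \<le> m\<^sup>2"
  proof -
    have "(\<Sum>i<k. (a i)\<^sup>2) \<le> (\<Sum>i<k. m * a i)"
      using am a0 unfolding power2_eq_square by (intro sum_mono mult_right_mono) auto
    then show ?thesis by (simp add: power2_eq_square m flip: sum_distrib_left)
  qed
  have km: "2 * m\<^sup>2 \<le> real k * m\<^sup>2" "0 \<le> m\<^sup>2"
    using k2 by (auto intro: mult_right_mono)
  have star: "(\<Sum>i<k. (a i)\<^sup>2 * (m - a i)) + (\<Sum>i<k. \<Sum>j\<in>{..<k} - {i}. S i j) = star_cubic k a"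
    using star_cubic_pairs[where k = k and a = a] by (simp add: m S_def)
  have split: "(\<Sum>i<k. \<Sum>j<k. leg_pair_sum ns i j)
      = (\<Sum>i<k. leg_pair_sum ns i i) + (\<Sum>i<k. \<Sum>j\<in>{..<k} - {i}. leg_pair_sum ns i j)"
    by (simp add: sum_off_diagonal)
  have off_a: "(\<Sum>i<k. \<Sum>j\<in>{..<k} - {i}. m * a i) \<le> real k * m\<^sup>2"
  proof -
    have "(\<Sum>i<k. \<Sum>j\<in>{..<k} - {i}. m * a i) \<le> (\<Sum>i<k. \<Sum>j<k. m * a i)"
      using a0 m0 by (intro sum_mono sum_mono2) auto
    also have "\<dots> = real k * m\<^sup>2"
      by (simp add: power2_eq_square m flip: sum_distrib_left)
    finally show ?thesis .
  qed

  have "(\<Sum>i<k. leg_pair_sum ns i i) \<le> (\<Sum>i<k. (a i)\<^sup>2 * (m - a i) + (a i)\<^sup>2 + (c i) ^ 3 / 3)"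
    unfolding c by (intro sum_mono) (use leg_pair_sum_same_bounds in \<open>auto simp: a_def m_def k_def\<close>)
  also have "\<dots> = (\<Sum>i<k. (a i)\<^sup>2 * (m - a i)) + (\<Sum>i<k. (a i)\<^sup>2) + (\<Sum>i<k. (c i) ^ 3 / 3)"
    by (simp only: sum.distrib)
  finally have diag_upper: "(\<Sum>i<k. leg_pair_sum ns i i)
      \<le> (\<Sum>i<k. (a i)\<^sup>2 * (m - a i)) + (\<Sum>i<k. (a i)\<^sup>2) + (\<Sum>i<k. (c i) ^ 3 / 3)" .
  have "(\<Sum>i<k. \<Sum>j\<in>{..<k} - {i}. leg_pair_sum ns i j)
      \<le> (\<Sum>i<k. \<Sum>j\<in>{..<k} - {i}. S i j + (a j * (c i)\<^sup>2 + a i * (c j)\<^sup>2) + 3 * (m * a i))"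
  proof (intro sum_mono)
    fix i j assume "i \<in> {..<k}" "j \<in> {..<k} - {i}"
    then show "leg_pair_sum ns i j \<le> S i j + (a j * (c i)\<^sup>2 + a i * (c j)\<^sup>2) + 3 * (m * a i)"
      using leg_pair_sum_cross_bounds(1)[of i ns j] by (simp add: S_def a_def m_def k_def c)
  qed
  also have "\<dots> = (\<Sum>i<k. \<Sum>j\<in>{..<k} - {i}. S i j)
      + (\<Sum>i<k. \<Sum>j\<in>{..<k} - {i}. a j * (c i)\<^sup>2 + a i * (c j)\<^sup>2)
      + 3 * (\<Sum>i<k. \<Sum>j\<in>{..<k} - {i}. m * a i)"
    by (simp only: sum.distrib sum_distrib_left)
  also have "(\<Sum>i<k. \<Sum>j\<in>{..<k} - {i}. a j * (c i)\<^sup>2 + a i * (c j)\<^sup>2)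
      = (\<Sum>i<k. 2 * (m - a i) * (c i)\<^sup>2)"
  proof -
    have "(\<Sum>i<k. \<Sum>j<k. a i * (c j)\<^sup>2) = (\<Sum>j<k. \<Sum>i<k. a i * (c j)\<^sup>2)"
      by (rule sum.swap)
    then have "(\<Sum>i<k. \<Sum>j<k. a j * (c i)\<^sup>2 + a i * (c j)\<^sup>2) = 2 * (\<Sum>i<k. m * (c i)\<^sup>2)"
      by (simp add: sum.distrib m flip: sum_distrib_right)
    then show ?thesis
      unfolding sum_off_diagonal
      by (simp add: sum_distrib_left sum_subtractf[symmetric] algebra_simps)
  qed
  finally have off_upper: "(\<Sum>i<k. \<Sum>j\<in>{..<k} - {i}. leg_pair_sum ns i j)
      \<le> (\<Sum>i<k. \<Sum>j\<in>{..<k} - {i}. S i j) + (\<Sum>i<k. 2 * (m - a i) * (c i)\<^sup>2)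
        + 3 * (\<Sum>i<k. \<Sum>j\<in>{..<k} - {i}. m * a i)" .
  have "2 * real_of_int (uB (subdivided_star ns))
      \<le> (\<Sum>i<k. \<Sum>j<k. leg_pair_sum ns i j) + 2 * (m * (m + 1))"
    unfolding m_def k_def by (rule two_uB_leg_pair_sums)
  also have "2 * (m * (m + 1)) = 2 * m\<^sup>2 + 2 * m"
    by (simp add: power2_eq_square algebra_simps)
  finally have "2 * real_of_int (uB (subdivided_star ns)) \<le> star_cubic k a
      + ((\<Sum>i<k. (c i) ^ 3 / 3) + (\<Sum>i<k. 2 * (m - a i) * (c i)\<^sup>2)) + 6 * (real k * m\<^sup>2) + 2 * m"
    using diag_upper off_upper off_a sq km star split by linarith
  then show "2 * real_of_int (uB (subdivided_star ns))
    \<le> star_cubic k a + (\<Sum>i<k. (leg_excess k a i) ^ 3 / 3 + 2 * (m - a i) * (leg_excess k a i)\<^sup>2)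
      + 6 * real k * m\<^sup>2 + 2 * m"
    by (simp add: c_def sum.distrib mult.assoc)

  have "(\<Sum>i<k. (a i)\<^sup>2 * (m - a i) - m * a i) \<le> (\<Sum>i<k. leg_pair_sum ns i i)"
    by (intro sum_mono) (use leg_pair_sum_same_bounds in \<open>auto simp: a_def m_def k_def\<close>)
  moreover have "(\<Sum>i<k. (a i)\<^sup>2 * (m - a i) - m * a i) = (\<Sum>i<k. (a i)\<^sup>2 * (m - a i)) - m\<^sup>2"
    by (simp add: sum_subtractf m power2_eq_square flip: sum_distrib_left)
  moreover have "(\<Sum>i<k. \<Sum>j\<in>{..<k} - {i}. S i j - 2 * (a i * a j) - m * a i)
      \<le> (\<Sum>i<k. \<Sum>j\<in>{..<k} - {i}. leg_pair_sum ns i j)"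
  proof (intro sum_mono)
    fix i j assume "i \<in> {..<k}" "j \<in> {..<k} - {i}"
    then show "S i j - 2 * (a i * a j) - m * a i \<le> leg_pair_sum ns i j"
      using leg_pair_sum_cross_bounds(2)[of i ns j] by (simp add: S_def a_def m_def k_def)
  qed
  moreover have "(\<Sum>i<k. \<Sum>j\<in>{..<k} - {i}. S i j - 2 * (a i * a j) - m * a i)
      = (\<Sum>i<k. \<Sum>j\<in>{..<k} - {i}. S i j) - 2 * (\<Sum>i<k. \<Sum>j\<in>{..<k} - {i}. a i * a j)
        - (\<Sum>i<k. \<Sum>j\<in>{..<k} - {i}. m * a i)"
    by (simp only: sum_subtractf sum_distrib_left)
  moreover have "(\<Sum>i<k. \<Sum>j\<in>{..<k} - {i}. a i * a j) \<le> m\<^sup>2"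
  proof -
    have "(\<Sum>i<k. \<Sum>j\<in>{..<k} - {i}. a i * a j) \<le> (\<Sum>i<k. \<Sum>j<k. a i * a j)"
      using a0 by (intro sum_mono sum_mono2) auto
    also have "\<dots> = m\<^sup>2"
      by (simp add: power2_eq_square m flip: sum_distrib_left sum_distrib_right)
    finally show ?thesis .
  qed
  moreover have "(\<Sum>i<k. \<Sum>j<k. leg_pair_sum ns i j) \<le> 2 * real_of_int (uB (subdivided_star ns))"
    unfolding k_def by (rule two_uB_leg_pair_sums)
  ultimately have "star_cubic k a - 4 * (real k * m\<^sup>2) \<le> 2 * real_of_int (uB (subdivided_star ns))"
    using off_a km star split by linarith
  then show "star_cubic k a - 4 * real k * m\<^sup>2 \<le> 2 * real_of_int (uB (subdivided_star ns))"
    by (simp add: mult.assoc)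
qed

text \<open>
  The value factors as \<open>(1 - 1/k) (1 - 2/(3k))\<close>.
\<close>

lemma balanced_value_bounds:
  assumes "2 \<le> k"
  shows "0 \<le> balanced_value k" "balanced_value k \<le> 1"
proof -
  have k: "2 \<le> real k" using assms by simp
  have eq: "balanced_value k = (1 - 1 / real k) * (1 - 2 / (3 * real k))"
    using k by (simp add: balanced_value_def field_simps power2_eq_square)
  have "0 \<le> 1 - 1 / real k" "1 - 1 / real k \<le> 1"
    "0 \<le> 1 - 2 / (3 * real k)" "1 - 2 / (3 * real k) \<le> 1"
    using k by (simp_all add: field_simps)
  then show "0 \<le> balanced_value k" "balanced_value k \<le> 1"
    unfolding eq by (simp_all add: mult_le_one)
qed

theorem theorem2:
  shows "\<exists>C::real. \<forall>k n::nat. 2 \<le> k \<and> k < n \<longrightarrow>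
    \<bar>real_of_int (Max {uB (subdivided_star ns) | ns.
          length ns = k \<and> (\<forall>m \<in> set ns. 0 < m) \<and> 1 + sum_list ns = n})
      - (1/2 - 5 / (6 * real k) + 1 / (3 * (real k)^2)) * (real n)^3\<bar>
    \<le> C * (real k * (real n)^2)"
proof (intro exI[of _ 8] allI impI)
  fix k n :: nat
  assume kn: "2 \<le> k \<and> k < n"
  define A where "A = {uB (subdivided_star ns) | ns.
      length ns = k \<and> (\<forall>m \<in> set ns. 0 < m) \<and> 1 + sum_list ns = n}"
  define m where "m = n - 1"
  \<comment> \<open>The cubic bounds are in terms of \<open>m = n - 1\<close>; passing to \<open>n\<close> changes \<open>m\<^sup>3\<close> by \<open>O(m\<^sup>2)\<close>.\<close>
  have n: "n = 1 + m" "k \<le> m" "0 < m" using kn by (auto simp: m_def)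
  have k: "2 \<le> k" "2 \<le> real k" using kn by auto
  let ?\<beta> = "balanced_value k"
  note \<beta> = balanced_value_bounds[OF k(1)]
  have m1: "1 \<le> real m" using n by simp
  have mm: "real m \<le> (real m)\<^sup>2" "1 \<le> (real m)\<^sup>2"
    using m1 by (simp_all add: power2_eq_square mult_ge1_I)
  have mk: "2 * (real m)\<^sup>2 \<le> real k * (real m)\<^sup>2"
    using k by (intro mult_right_mono) auto
  have fin: "finite A"
  proof (rule finite_surj)
    show "finite {ns. set ns \<subseteq> {..n} \<and> length ns = k}"
      by (rule finite_lists_length_eq) simp
    show "A \<subseteq> (\<lambda>ns. uB (subdivided_star ns)) ` {ns. set ns \<subseteq> {..n} \<and> length ns = k}"
    proof
      fix z assume "z \<in> A"
      then obtain ns where "z = uB (subdivided_star ns)" "length ns = k" "1 + sum_list ns = n"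
        by (auto simp: A_def)
      moreover have "set ns \<subseteq> {..n}"
        using member_le_sum_list[of _ ns] \<open>1 + sum_list ns = n\<close> by fastforce
      ultimately show "z \<in> (\<lambda>ns. uB (subdivided_star ns)) ` {ns. set ns \<subseteq> {..n} \<and> length ns = k}"
        by blast
    qed
  qed
  have upper: "2 * real_of_int z \<le> ?\<beta> * real m ^ 3 + 7 * (real k * (real m)\<^sup>2)" if "z \<in> A" for z
  proof -
    from that obtain ns where ns: "z = uB (subdivided_star ns)" "length ns = k" "sum_list ns = m"
      by (auto simp: A_def n)
    then have "(\<Sum>i<k. real (ns ! i)) = real m"
      by (auto simp: sum_list_sum_nth atLeast0LessThan)
    with star_cubic_excess_le_balanced[OF k(1), of "\<lambda>i. real (ns ! i)"] m1
    have "star_cubic k (\<lambda>i. real (ns ! i))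
        + (\<Sum>i<k. (leg_excess k (\<lambda>i. real (ns ! i)) i) ^ 3 / 3
          + 2 * (real m - real (ns ! i)) * (leg_excess k (\<lambda>i. real (ns ! i)) i)\<^sup>2)
        \<le> ?\<beta> * real m ^ 3"
      by simp
    moreover have "2 * real_of_int z \<le> star_cubic k (\<lambda>i. real (ns ! i))
        + (\<Sum>i<k. (leg_excess k (\<lambda>i. real (ns ! i)) i) ^ 3 / 3
          + 2 * (real m - real (ns ! i)) * (leg_excess k (\<lambda>i. real (ns ! i)) i)\<^sup>2)
        + 6 * (real k * (real m)\<^sup>2) + 2 * real m"
      using two_uB_star_cubic_bounds(1)[of ns] ns k by (simp add: mult.assoc)
    ultimately show ?thesis using mm mk by linarith
  qed
  obtain z where z: "z \<in> A" "?\<beta> * real m ^ 3 - 7 * (real k * (real m)\<^sup>2) \<le> 2 * real_of_int z"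
  proof -
    \<comment> \<open>The witness is the most even distribution of \<open>m\<close> over \<open>k\<close> legs.\<close>
    define q r where "q = m div k" and "r = m mod k"
    define ns where "ns = replicate r (q + 1) @ replicate (k - r) q"
    have "r < k" using k by (simp add: r_def)
    then have len: "length ns = k" by (simp add: ns_def)
    have q: "1 \<le> q" using n k by (simp add: q_def div_greater_zero_iff Suc_le_eq)
    have qr: "m = k * q + r" by (simp add: q_def r_def)
    have "sum_list ns = r * (q + 1) + (k - r) * q"
      by (simp add: ns_def sum_list_replicate)
    also have "\<dots> = k * q + r"
      using \<open>r < k\<close> by (simp add: algebra_simps diff_mult_distrib2)
    finally have sum: "sum_list ns = m" using qr by simp
    have le: "x \<le> q + 1" "0 < x" if "x \<in> set ns" for x
      using that q by (auto simp: ns_def split: if_splits)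
    have "real q \<le> real m / real k"
      using k qr by (simp add: field_simps flip: of_nat_mult)
    then have le': "real (ns ! i) \<le> real m / real k + 1" if "i < k" for i
      using le(1)[of "ns ! i"] that len by (simp flip: of_nat_Suc)
    have sum': "(\<Sum>i<k. real (ns ! i)) = real m"
      using sum len by (auto simp: sum_list_sum_nth atLeast0LessThan)
    have "?\<beta> * real m ^ 3 - 6 * (real m)\<^sup>2 \<le> star_cubic k (\<lambda>i. real (ns ! i))"
      using n le' sum' k by (intro balanced_le_star_cubic) auto
    then have "?\<beta> * real m ^ 3 - 7 * (real k * (real m)\<^sup>2) \<le> 2 * real_of_int (uB (subdivided_star ns))"
      using two_uB_star_cubic_bounds(2)[of ns] len sum k mk by (simp add: mult.assoc)
    moreover have "uB (subdivided_star ns) \<in> A"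
      unfolding A_def using len sum le n by blast
    ultimately show ?thesis using that by blast
  qed
  have "A \<noteq> {}" using z by blast
  have lower: "?\<beta> * real m ^ 3 - 7 * (real k * (real m)\<^sup>2) \<le> 2 * real_of_int (Max A)"
  proof -
    have "real_of_int z \<le> real_of_int (Max A)" using z fin by simp
    with z show ?thesis by linarith
  qed
  have upper: "2 * real_of_int (Max A) \<le> ?\<beta> * real m ^ 3 + 7 * (real k * (real m)\<^sup>2)"
    using upper Max_in[OF fin \<open>A \<noteq> {}\<close>] by blast
  have cubes: "?\<beta> * real m ^ 3 \<le> ?\<beta> * real n ^ 3"
      "?\<beta> * real n ^ 3 \<le> ?\<beta> * real m ^ 3 + 7 * (real m)\<^sup>2"
  proof -
    have n3: "real n ^ 3 = real m ^ 3 + (3 * (real m)\<^sup>2 + 3 * real m + 1)"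
      by (simp add: n power2_eq_square power3_eq_cube algebra_simps)
    have "3 * (real m)\<^sup>2 + 3 * real m + 1 \<le> 7 * (real m)\<^sup>2"
      using mm by linarith
    then have "?\<beta> * (3 * (real m)\<^sup>2 + 3 * real m + 1) \<le> 1 * (7 * (real m)\<^sup>2)"
      using \<beta> by (intro mult_mono) auto
    then show "?\<beta> * real n ^ 3 \<le> ?\<beta> * real m ^ 3 + 7 * (real m)\<^sup>2"
      unfolding n3 by (simp add: distrib_left)
    show "?\<beta> * real m ^ 3 \<le> ?\<beta> * real n ^ 3"
      using \<beta> n by (intro mult_left_mono power_mono) auto
  qed
  have "real k * (real m)\<^sup>2 \<le> real k * (real n)\<^sup>2"
    using n by (intro mult_left_mono power_mono) auto
  with upper lower cubes mk
  have "\<bar>2 * real_of_int (Max A) - ?\<beta> * real n ^ 3\<bar> \<le> 16 * (real k * (real n)\<^sup>2)"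
    by linarith
  moreover have "?\<beta> * real n ^ 3
      = 2 * ((1/2 - 5 / (6 * real k) + 1 / (3 * (real k)^2)) * (real n)^3)"
    by (simp add: balanced_value_def field_simps)
  ultimately show "\<bar>real_of_int (Max {uB (subdivided_star ns) | ns.
          length ns = k \<and> (\<forall>m \<in> set ns. 0 < m) \<and> 1 + sum_list ns = n})
      - (1/2 - 5 / (6 * real k) + 1 / (3 * (real k)^2)) * (real n)^3\<bar>
    \<le> 8 * (real k * (real n)^2)"
    unfolding A_def[symmetric] by linarith
qed

end
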